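(* Let $N\ge 1$ and $s\in(0,1)$. Then $$\mathfrak h_{s,1}(\mathbb H^N_+)=\Lambda_{s,1}\,C_{N,s}\quad\text{with}\quad \Lambda_{s,1}=\frac4s,$$ and, whenever $\Omega\subsetneq\mathbb R^N$ is a non-empty open convex set, $$\frac12\,\mathfrak h_{s,1}(\mathbb H^N_+)\le \mathfrak h_{s,1}(\Omega)\le \mathfrak h_{s,1}(\mathbb H^N_+).$$ Moreover, the constant $\mathfrak h_{s,1}(\mathbb H^1_+)$ is attained in $\mathcal W^{s,1}_0(\mathbb H^1_+)$.
   Context: For $N\ge1$, a non-empty open set $\Omega\subsetneq\mathbb R^N$ and $x\in\Omega$, $d_\Omega(x)=\inf_{y\in\partial\Omega}|x-y|$. $C^\infty_0(\Omega)$ is the set of smooth real functions on $\mathbb R^N$ with compact support contained in $\Omega$. For $s\in(0,1)$ and measurable $u$ on $\mathbb R^N$, $$[u]_{W^{s,1}(\mathbb R^N)}=\int_{\mathbb R^N}\int_{\mathbb R^N}\frac{|u(x)-u(y)|}{|x-y|^{N+s}}\,dx\,dy,$$ $$\mathfrak h_{s,1}(\Omega)=\inf_{u\in C^\infty_0(\Omega)}\Big\{[u]_{W^{s,1}(\mathbb R^N)}:\int_\Omega\frac{|u|}{d_\Omega^s}\,dx=1\Big\}\in[0,\infty).$$ $\mathbb H^1_+=(0,\infty)$ and $\mathbb H^N_+=\mathbb R^{N-1}\times(0,\infty)$ for $N\ge2$. For $q\ge0$: $C_{1,q}=1$ and, for $N\ge2$, $C_{N,q}=(N-1)\,\omega_{N-1}\int_0^\infty\frac{t^{N-2}}{(1+t^2)^{(N+q)/2}}\,dt$,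 where $\omega_{k}$ is the Lebesgue measure of the unit ball of $\mathbb R^{k}$. Moreover $\Lambda_{s,1}=2\int_0^1\frac{|1-t^{s-1}|}{(1-t)^{1+s}}\,dt+\frac2s$. $\mathcal W^{s,1}_0(\Omega)$ is the completion of $C_0^\infty(\Omega)$ with respect to $[\cdot]_{W^{s,1}(\mathbb R^N)}$, identified with a space of functions, namely the closure of $C^\infty_0(\Omega)$ in $\{u\in L^{N/(N-s)}(\mathbb R^N):[u]_{W^{s,1}(\mathbb R^N)}<\infty\}$ with respect to this seminorm. "$\mathfrak h_{s,1}(\Omega)$ is attained in $\mathcal W^{s,1}_0(\Omega)$" means that there is $u\in\mathcal W^{s,1}_0(\Omega)$ with $\int_\Omega |u|/d_\Omega^s\,dx=1$ and $[u]_{W^{s,1}(\mathbb R^N)}=\mathfrak h_{s,1}(\Omega)$. *)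

theory Defs
  imports "HOL-Analysis.Analysis"
begin

primrec times_cont_differentiable :: "nat \<Rightarrow> ('a::euclidean_space \<Rightarrow> real) \<Rightarrow> bool" where
  "times_cont_differentiable 0 f \<longleftrightarrow> continuous_on UNIV f"
| "times_cont_differentiable (Suc k) f \<longleftrightarrow>
     (\<forall>x. f differentiable (at x)) \<and>
     (\<forall>v. times_cont_differentiable k (\<lambda>x. frechet_derivative f (at x) v))"

definition smooth_compact_support :: "'a::euclidean_space set \<Rightarrow> ('a \<Rightarrow> real) set" where
  "smooth_compact_support \<Omega> =
     {u. (\<forall>k. times_cont_differentiable k u) \<and>
         compact (closure {x. u x \<noteq> 0}) \<and> closure {x. u x \<noteq> 0} \<subseteq> \<Omega>}"

definition boundary_dist :: "'a::euclidean_space set \<Rightarrow> 'a \<Rightarrow> real" where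
  "boundary_dist \<Omega> x = infdist x (frontier \<Omega>)"

(* On the diagonal the integrand is 0 / 0 = 0; the diagonal is a null set. *)
definition gagliardo :: "real \<Rightarrow> ('a::euclidean_space \<Rightarrow> real) \<Rightarrow> ennreal" where
  "gagliardo s u =
     (\<integral>\<^sup>+ x. (\<integral>\<^sup>+ y. ennreal (\<bar>u x - u y\<bar> / norm (x - y) powr (real DIM('a) + s)) \<partial>lborel) \<partial>lborel)"

definition hardy_integral :: "real \<Rightarrow> 'a::euclidean_space set \<Rightarrow> ('a \<Rightarrow> real) \<Rightarrow> ennreal" where
  "hardy_integral s \<Omega> u =
     (\<integral>\<^sup>+ x \<in> \<Omega>. ennreal (\<bar>u x\<bar> / boundary_dist \<Omega> x powr s) \<partial>lborel)"

definition hardy_const :: "real \<Rightarrow> 'a::euclidean_space set \<Rightarrow> ennreal" where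
  "hardy_const s \<Omega> =
     (INF u \<in> {u \<in> smooth_compact_support \<Omega>. hardy_integral s \<Omega> u = 1}. gagliardo s u)"

(* The closure of the test functions, with respect to the seminorm, inside the functions in
   L^(N/(N-s)) of finite seminorm.  A class modulo null sets is given by a Borel representative. *)
definition W0_space :: "real \<Rightarrow> 'a::euclidean_space set \<Rightarrow> ('a \<Rightarrow> real) set" where
  "W0_space s \<Omega> =
     {u. u \<in> borel_measurable lborel \<and>
         (\<integral>\<^sup>+ x. ennreal (\<bar>u x\<bar> powr (real DIM('a) / (real DIM('a) - s))) \<partial>lborel) < \<infinity> \<and>
         gagliardo s u < \<infinity> \<and>
         (\<forall>\<epsilon>>0. \<exists>\<phi> \<in> smooth_compact_support \<Omega>. gagliardo s (\<lambda>x. u x - \<phi> x) < ennreal \<epsilon>)}"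

definition hardy_const_attained :: "real \<Rightarrow> 'a::euclidean_space set \<Rightarrow> bool" where
  "hardy_const_attained s \<Omega> \<longleftrightarrow>
     (\<exists>u \<in> W0_space s \<Omega>. hardy_integral s \<Omega> u = 1 \<and> gagliardo s u = hardy_const s \<Omega>)"

(* For e in Basis, the half-space on which the coordinate along e is positive. *)
definition half_space :: "'a::euclidean_space \<Rightarrow> 'a set" where
  "half_space e = {x. 0 < x \<bullet> e}"

lemma half_space_real: "half_space (1::real) = {0<..}"
  by (auto simp: half_space_def)

(* unit_ball_vol (real k) is the Lebesgue measure of the unit ball of a k-dimensional Euclidean
   space: see content_ball, and emeasure_cball_aux for dimensions not given by a type. *)
definition C_const :: "nat \<Rightarrow> real \<Rightarrow> real" where
  "C_const N q =
     (if N = 1 then 1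
      else (real N - 1) * unit_ball_vol (real N - 1) *
           (LBINT t:{0<..}. t ^ (N - 2) / (1 + t\<^sup>2) powr ((real N + q) / 2)))"

definition Lambda_const :: "real \<Rightarrow> real" where
  "Lambda_const s =
     2 * (LBINT t:{0<..<1}. \<bar>1 - t powr (s - 1)\<bar> / (1 - t) powr (1 + s)) + 2 / s"

end

theory Submission
  imports Defs "HOL-Real_Asymp.Real_Asymp"
begin

text \<open>Write $N$ for the dimension, $k(h) = |h|^{-N-s}$ and $D_u(h) = \int |u(x) - u(x+h)|\,dx$.  The
  substitution $y = x + h$ and Tonelli's theorem give $[u] = \int k(h) D_u(h)\,dh$
  (\<open>gagliardo_eq_shift_diff\<close>), and all estimates of the seminorm are estimates of $D_u$.  The other
  ingredient is that the mass of $k$ beyond a hyperplane at distance $t$ from the origin is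
  $t^{-s} C_{N,s} / s$, in every direction (\<open>kernel_half_space\<close>).

  Lower bound on the half-space $x \cdot e > 0$.  Let $h \cdot e > 0$ and let $u$ vanish off the
  half-space.  Translation by $h$ preserves the mass of $|u|$, but the slab
  $0 < x \cdot e \le h \cdot e$ contains mass of $|u|$ on one side of the comparison and none on the
  other; hence $D_u(h)$ is at least twice the mass of $|u|$ in this slab
  (\<open>half_space_shift_lower_bound\<close>).  Integrating against $k$ over $h$ and exchanging the integrals turns
  the slab condition into the tail of $k$ beyond $x \cdot e$, that is, into the weight
  $(x \cdot e)^{-s}$.  The two signs of $h \cdot e$ contribute equally, and the constant is
  $4 C_{N,s} / s$ (\<open>gagliardo_half_space_lower_bound\<close>).

  Lower bound on a convex set.  Only the pairs with one point in $\Omega$ and the other outside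
  are kept.  Seen from $x \in \Omega$ the complement contains a half-space at distance at most
  $d_\Omega(x)$, whence the constant $2 C_{N,s} / s$, half of the previous one
  (\<open>gagliardo_convex_lower_bound\<close>).

  Sharpness on the half-space.  The indicator of $(0,L)$ is extremal in dimension one.  In general
  smoothed boxes of width $L$ along $e$ and $L^2$ in the other directions do the job: $D_u$ is
  subadditive in $h$, so it is bounded by its values along the axes, and the lateral faces become
  negligible as $L \to \infty$ (\<open>box_test_function\<close>, \<open>hardy_const_half_space_le\<close>).

  Upper bound on a convex set.  A ball inscribed in $\Omega$ that touches the boundary at $p$ is
  tangent there to the supporting hyperplane.  A test function of the half-space, rotated, moved to
  $p$ and scaled down far enough, is supported in this ball; as $d_\Omega$ is at most the distance to
  the hyperplane, its quotient does not increase
  (\<open>hardy_const_convex_le_half_space\<close>).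

  On the half-line $(1-s)$ times the indicator of $(0,1]$ is a minimizer.  Replacing its two
  jumps by smooth steps of width $\delta$ changes it by $O(\delta^{1-s})$ in the seminorm
  (\<open>hardy_const_half_line_attained\<close>).  Finally $(t^s - 1)(1-t)^{-s}/s$ is a primitive of the
  integrand in $\Lambda_{s,1}$ (\<open>Lambda_const_eq\<close>).\<close>

section \<open>Smooth functions\<close>

lemma times_cont_differentiable_SucI:
  assumes "\<And>x. (f has_derivative f' x) (at x)" "\<And>v. times_cont_differentiable k (\<lambda>x. f' x v)"
  shows "times_cont_differentiable (Suc k) f"
proof -
  have eq: "frechet_derivative f (at x) = f' x" for x
    using frechet_derivative_at[OF assms(1)] by simp
  have "f differentiable (at x)" for x
    using assms(1) by (rule differentiableI)
  with assms(2) show ?thesis by (simp add: eq)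
qed

lemma times_cont_differentiable_SucD:
  assumes "times_cont_differentiable (Suc k) f"
  shows "(f has_derivative frechet_derivative f (at x)) (at x)"
    and "times_cont_differentiable k (\<lambda>x. frechet_derivative f (at x) v)"
  using assms by (auto simp: frechet_derivative_works)

lemma times_cont_differentiable_lower: "times_cont_differentiable (Suc k) f \<Longrightarrow> times_cont_differentiable k f"
proof (induction k arbitrary: f)
  case 0
  then show ?case
    by (auto simp: continuous_on_eq_continuous_at intro: differentiable_imp_continuous_within)
next
  case (Suc k)
  show ?case
    by (rule times_cont_differentiable_SucI[OF times_cont_differentiable_SucD(1)[OF Suc.prems]]) (rule Suc.IH[OF times_cont_differentiable_SucD(2)[OF Suc.prems]])
qed

lemma times_cont_differentiable_const: "times_cont_differentiable k (\<lambda>x. c)"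
proof (induction k arbitrary: c)
  case (Suc k)
  show ?case by (rule times_cont_differentiable_SucI[where f'="\<lambda>x v. 0"]) (auto intro!: Suc.IH)
qed simp

lemma times_cont_differentiable_add:
  "times_cont_differentiable k f \<Longrightarrow> times_cont_differentiable k g \<Longrightarrow>
   times_cont_differentiable k (\<lambda>x. f x + g x)"
proof (induction k arbitrary: f g)
  case (Suc k)
  show ?case
    by (rule times_cont_differentiable_SucI[OF has_derivative_add[OF times_cont_differentiable_SucD(1)[OF Suc.prems(1)] times_cont_differentiable_SucD(1)[OF Suc.prems(2)]]])
       (rule Suc.IH[OF times_cont_differentiable_SucD(2)[OF Suc.prems(1)] times_cont_differentiable_SucD(2)[OF Suc.prems(2)]])
qed (auto intro: continuous_on_add continuous_on_mult)

lemma times_cont_differentiable_mult: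
  "times_cont_differentiable k f \<Longrightarrow> times_cont_differentiable k g \<Longrightarrow>
   times_cont_differentiable k (\<lambda>x. f x * g x)"
proof (induction k arbitrary: f g)
  case (Suc k)
  show ?case
    by (rule times_cont_differentiable_SucI[OF has_derivative_mult[OF times_cont_differentiable_SucD(1)[OF Suc.prems(1)] times_cont_differentiable_SucD(1)[OF Suc.prems(2)]]])
       (rule times_cont_differentiable_add[OF Suc.IH[OF times_cont_differentiable_lower[OF Suc.prems(1)] times_cont_differentiable_SucD(2)[OF Suc.prems(2)]]
          Suc.IH[OF times_cont_differentiable_SucD(2)[OF Suc.prems(1)] times_cont_differentiable_lower[OF Suc.prems(2)]]])
qed (auto intro: continuous_on_add continuous_on_mult)

lemma times_cont_differentiable_diff:
  "times_cont_differentiable k f \<Longrightarrow> times_cont_differentiable k g \<Longrightarrow>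
   times_cont_differentiable k (\<lambda>x. f x - g x)"
  using times_cont_differentiable_add[OF _ times_cont_differentiable_mult[OF times_cont_differentiable_const[of k "-1"]], of f g] by simp

lemma times_cont_differentiable_prod:
  assumes "\<And>i. i \<in> I \<Longrightarrow> times_cont_differentiable k (f i)"
  shows "times_cont_differentiable k (\<lambda>x. \<Prod>i\<in>I. f i x)"
  using assms by (induction I rule: infinite_finite_induct) (auto intro: times_cont_differentiable_const times_cont_differentiable_mult)

lemma times_cont_differentiable_affine:
  assumes "bounded_linear A"
  shows "times_cont_differentiable k f \<Longrightarrow> times_cont_differentiable k (\<lambda>x. f (A x + c))"
proof (induction k arbitrary: f)
  case 0
  have "continuous_on UNIV (\<lambda>x. A x + c)"
    by (intro continuous_on_add linear_continuous_on[OF assms] continuous_on_const)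
  from continuous_on_compose2[OF _ this, of UNIV f] 0 show ?case by simp
next
  case (Suc k)
  have "((\<lambda>x. A x + c) has_derivative A) (at x)" for x
    by (intro has_derivative_add_const bounded_linear.has_derivative[OF assms] has_derivative_ident)
  from has_derivative_compose[OF this times_cont_differentiable_SucD(1)[OF Suc.prems]]
  show ?case
    by (rule times_cont_differentiable_SucI) (intro Suc.IH[OF times_cont_differentiable_SucD(2)[OF Suc.prems]])
qed

lemma times_cont_differentiable_real_SucI:
  fixes f :: "real \<Rightarrow> real"
  assumes "\<And>x. (f has_real_derivative f' x) (at x)" "times_cont_differentiable k f'"
  shows "times_cont_differentiable (Suc k) f"
  by (rule times_cont_differentiable_SucI[OF assms(1)[unfolded has_field_derivative_def]])
     (intro times_cont_differentiable_mult assms times_cont_differentiable_const)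

text \<open>For the polynomial $1$ this is the usual flat function $e^{-1/x}$; a polynomial factor in $1/x$
  makes the family closed under differentiation, which gives smoothness by induction on the order.\<close>
definition exp_tail :: "real poly \<Rightarrow> real \<Rightarrow> real" where
  "exp_tail p x = (if 0 < x then poly p (1 / x) * exp (- (1 / x)) else 0)"

lemma tendsto_poly_exp: "((\<lambda>y. poly p y * exp (- y)) \<longlongrightarrow> (0::real)) at_top"
proof -
  have "((\<lambda>y. \<Sum>i\<le>degree p. coeff p i * (y ^ i / exp y)) \<longlongrightarrow> (\<Sum>i\<le>degree p. coeff p i * 0)) at_top"
    by (intro tendsto_sum tendsto_mult tendsto_const tendsto_power_div_exp_0)
  then show ?thesis
    by (simp add: poly_altdef sum_distrib_right sum_divide_distrib exp_minus field_simps)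
qed

lemma exp_tail_has_derivative:
  "(exp_tail p has_real_derivative exp_tail ([:0, 0, 1:] * (p - pderiv p)) x) (at x)"
proof -
  consider "x < 0" | "x = 0" | "0 < x" by linarith
  then show ?thesis
  proof cases
    case 1
    have "((\<lambda>x. 0) has_real_derivative 0) (at x)" by simp
    from has_field_derivative_transform_within_open[OF this open_lessThan[of 0], of "exp_tail p"] 1
    show ?thesis by (auto simp: exp_tail_def)
  next
    case 2
    have "filterlim (\<lambda>h::real. 1 / h) at_top (at_right 0)"
      using filterlim_inverse_at_top_right by (simp add: inverse_eq_divide)
    from filterlim_compose[OF tendsto_poly_exp[of "pCons 0 p"] this]
    have r: "((\<lambda>h. exp_tail p h / h) \<longlongrightarrow> 0) (at_right 0)"
      by (rule Lim_transform_eventually)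
        (auto simp: exp_tail_def eventually_at_right_less eventually_at_filter)
    have "((\<lambda>h. exp_tail p h / h) \<longlongrightarrow> 0) (at_left 0)"
      by (rule Lim_transform_eventually[OF tendsto_const])
        (auto simp: exp_tail_def eventually_at_filter)
    with r have "((\<lambda>h. exp_tail p h / h) \<longlongrightarrow> 0) (at 0)"
      by (simp add: filterlim_split_at)
    then show ?thesis unfolding 2 DERIV_def by (simp add: exp_tail_def)
  next
    case 3
    have inv: "((\<lambda>x. 1 / x) has_real_derivative - (1 / x\<^sup>2)) (at x)"
      using DERIV_inverse[of x] 3 by (simp add: inverse_eq_divide power2_eq_square)
    have "((\<lambda>x. poly p (1 / x) * exp (- (1 / x))) has_real_derivative
        poly (pderiv p) (1 / x) * - (1 / x\<^sup>2) * exp (- (1 / x))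
        + exp (- (1 / x)) * - (- (1 / x\<^sup>2)) * poly p (1 / x)) (at x)"
      by (intro DERIV_mult DERIV_chain2[OF poly_DERIV inv] DERIV_chain2[OF DERIV_exp DERIV_minus[OF inv]])
    also have "poly (pderiv p) (1 / x) * - (1 / x\<^sup>2) * exp (- (1 / x))
        + exp (- (1 / x)) * - (- (1 / x\<^sup>2)) * poly p (1 / x)
        = exp_tail ([:0, 0, 1:] * (p - pderiv p)) x"
      using 3 by (simp add: exp_tail_def algebra_simps power2_eq_square)
    finally have "((\<lambda>x. poly p (1 / x) * exp (- (1 / x))) has_real_derivative
        exp_tail ([:0, 0, 1:] * (p - pderiv p)) x) (at x)" .
    from has_field_derivative_transform_within_open[OF this open_greaterThan[of 0], of "exp_tail p"] 3
    show ?thesis by (auto simp: exp_tail_def)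
  qed
qed

lemma times_cont_differentiable_exp_tail: "times_cont_differentiable k (exp_tail p)"
proof (induction k arbitrary: p)
  case 0
  show ?case using DERIV_isCont[OF exp_tail_has_derivative]
    by (simp add: continuous_on_eq_continuous_at)
next
  case (Suc k)
  show ?case by (rule times_cont_differentiable_real_SucI[OF exp_tail_has_derivative Suc.IH])
qed

text \<open>Both the boxes and the approximation of the minimizer on the half-line are built from translated
  and rescaled copies of one such transition function.\<close>
locale smooth_step =
  fixes F :: "real \<Rightarrow> real"
  assumes smooth: "times_cont_differentiable k F" and mono_F: "mono F"
    and eq_0: "x \<le> 0 \<Longrightarrow> F x = 0" and eq_1: "1 \<le> x \<Longrightarrow> F x = 1"

lemma smooth_step_exists:
  obtains F where "smooth_step F"
proof -
  \<comment> \<open>The step is the normalized primitive of a bump supported in the unit interval.\<close>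
  define b where "b x = exp_tail 1 x * exp_tail 1 (1 - x)" for x
  have "times_cont_differentiable k (\<lambda>x. exp_tail 1 (1 - x))" for k
    using times_cont_differentiable_affine[OF bounded_linear_minus[OF bounded_linear_ident] times_cont_differentiable_exp_tail, of k 1 1] by simp
  then have b_smooth: "times_cont_differentiable k b" for k
    unfolding b_def by (intro times_cont_differentiable_mult times_cont_differentiable_exp_tail)
  have b0: "0 \<le> b x" and bpos: "0 < x \<Longrightarrow> x < 1 \<Longrightarrow> 0 < b x"
    and bz: "x \<le> 0 \<or> 1 \<le> x \<Longrightarrow> b x = 0" for x
    by (auto simp: b_def exp_tail_def)
  have "isCont b x" for x
    using b_smooth[of 0] by (simp add: continuous_on_eq_continuous_at)
  then obtain G where G: "\<And>x. (G has_real_derivative b x) (at x)"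
    using einterval_antiderivative[of "-\<infinity>" \<infinity> b]
    by (auto simp: has_real_derivative_iff_has_vector_derivative)
  have mono: "G x \<le> G y" if "x \<le> y" for x y
    using DERIV_nonneg_imp_nondecreasing[OF that] G b0 by blast
  have lt: "G 0 < G 1"
  proof (rule DERIV_pos_imp_increasing_open[of 0 1 G])
    show "\<exists>y. (G has_real_derivative y) (at x) \<and> 0 < y" if "0 < x" "x < 1" for x
      using G bpos[OF that] by blast
    show "continuous_on {0..1} G"
      by (intro continuous_at_imp_continuous_on ballI DERIV_isCont[OF G])
  qed simp
  have G0: "G x = G 0" if "x \<le> 0" for x
  proof -
    have "G 0 \<le> G x"
    proof (rule DERIV_nonpos_imp_nonincreasing[OF that])
      show "\<exists>y. (G has_real_derivative y) (at t) \<and> y \<le> 0" if "t \<le> 0" for t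
        using G[of t] bz[of t] that by auto
    qed
    with mono[OF that] show ?thesis by simp
  qed
  have G1: "G x = G 1" if "1 \<le> x" for x
  proof -
    have "G x \<le> G 1"
    proof (rule DERIV_nonpos_imp_nonincreasing[OF that])
      show "\<exists>y. (G has_real_derivative y) (at t) \<and> y \<le> 0" if "1 \<le> t" for t
        using G[of t] bz[of t] that by auto
    qed
    with mono[OF that] show ?thesis by simp
  qed
  have G_smooth: "times_cont_differentiable k G" for k
    by (rule times_cont_differentiable_lower) (rule times_cont_differentiable_real_SucI[OF G b_smooth])
  show ?thesis
  proof (rule that, rule smooth_step.intro)
    show "times_cont_differentiable k (\<lambda>x. 1 / (G 1 - G 0) * (G x - G 0))" for k
      by (intro times_cont_differentiable_mult times_cont_differentiable_diff times_cont_differentiable_const G_smooth)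
    show "mono (\<lambda>x. 1 / (G 1 - G 0) * (G x - G 0))"
    proof (rule monoI)
      fix x y :: real assume "x \<le> y"
      then have "G x - G 0 \<le> G y - G 0" using mono by simp
      moreover have "0 \<le> 1 / (G 1 - G 0)" using lt by simp
      ultimately show "1 / (G 1 - G 0) * (G x - G 0) \<le> 1 / (G 1 - G 0) * (G y - G 0)"
        by (rule mult_left_mono)
    qed
    show "1 / (G 1 - G 0) * (G x - G 0) = 0" if "x \<le> 0" for x
      by (simp add: G0[OF that])
    show "1 / (G 1 - G 0) * (G x - G 0) = 1" if "1 \<le> x" for x
      unfolding G1[OF that] using lt by simp
  qed
qed

section \<open>Invariance of Lebesgue measure under similarities\<close>

lemma nn_integral_lborel_add:
  fixes c :: "'a::euclidean_space"
  assumes [measurable]: "g \<in> borel_measurable borel"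
  shows "(\<integral>\<^sup>+ x. g (c + x) \<partial>lborel) = (\<integral>\<^sup>+ x. g x \<partial>lborel)"
  by (subst (2) lborel_distr_plus[of c, symmetric]) (simp add: nn_integral_distr)

lemma nn_integral_lborel_scaleR:
  fixes g :: "'a::euclidean_space \<Rightarrow> ennreal"
  assumes [measurable]: "g \<in> borel_measurable borel" and "c \<noteq> 0"
  shows "(\<integral>\<^sup>+ x. g x \<partial>lborel) = ennreal (\<bar>c\<bar> ^ DIM('a)) * (\<integral>\<^sup>+ x. g (t + c *\<^sub>R x) \<partial>lborel)"
  by (subst lborel_affine[OF assms(2), of t])
     (simp add: nn_integral_density nn_integral_distr nn_integral_cmult)

lemma nn_integral_lborel_uminus:
  fixes g :: "'a::euclidean_space \<Rightarrow> ennreal"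
  assumes "g \<in> borel_measurable borel"
  shows "(\<integral>\<^sup>+ x. g (- x) \<partial>lborel) = (\<integral>\<^sup>+ x. g x \<partial>lborel)"
  using nn_integral_lborel_scaleR[OF assms, of "-1" 0] by simp

text \<open>Uniqueness of translation invariant measures, in integral form.  Integrating
  $\varphi(f(y))\,g(f(y) + x)$ over $x$ and $y$ in either order, where $\varphi$ is the indicator of the
  unit ball, gives the volume of the ball times $\int g$ on the one hand and times
  $\int g \circ f$ on the other: the isometry fixes the ball, and the ball is symmetric.\<close>
lemma nn_integral_lborel_isometry:
  fixes f :: "'a::euclidean_space \<Rightarrow> 'a"
  assumes lin: "linear f" and iso: "\<And>x. norm (f x) = norm x"
    and [measurable]: "g \<in> borel_measurable borel"
  shows "(\<integral>\<^sup>+ x. g (f x) \<partial>lborel) = (\<integral>\<^sup>+ x. g x \<partial>lborel)"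
proof -
  interpret linear f by fact
  have [measurable]: "f \<in> borel_measurable borel"
    using linear_continuous_on[OF lin[unfolded linear_conv_bounded_linear]]
    by (rule borel_measurable_continuous_onI)
  have "inj f"
    using iso by (intro linear_injective_0[OF lin, THEN iffD2]) (metis norm_eq_zero)
  then have surj: "surj f"
    using lin linear_injective_imp_surjective by blast
  define \<phi> where "\<phi> x = (indicator (ball 0 1) x :: ennreal)" for x :: 'a
  have [measurable]: "\<phi> \<in> borel_measurable borel"
    unfolding \<phi>_def by (intro borel_measurable_indicator) simp
  have \<phi>f: "\<phi> (f x) = \<phi> x" and \<phi>m: "\<phi> (- x) = \<phi> x" for x
    by (auto simp: \<phi>_def indicator_def iso)
  define I where "I = (\<integral>\<^sup>+ x. \<phi> x \<partial>lborel)"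
  have I: "I = ennreal (unit_ball_vol DIM('a))"
    unfolding I_def \<phi>_def using emeasure_ball[of 1 "0::'a"] by simp
  have "I * (\<integral>\<^sup>+ x. g x \<partial>lborel) = (\<integral>\<^sup>+ y. \<phi> (f y) * (\<integral>\<^sup>+ x. g (f y + x) \<partial>lborel) \<partial>lborel)"
    by (simp add: nn_integral_lborel_add I_def \<phi>f nn_integral_multc)
  also have "\<dots> = (\<integral>\<^sup>+ y. \<integral>\<^sup>+ x. \<phi> (f y) * g (f y + x) \<partial>lborel \<partial>lborel)"
    by (simp add: nn_integral_cmult)
  also have "\<dots> = (\<integral>\<^sup>+ x. \<integral>\<^sup>+ y. \<phi> (f y) * g (f y + x) \<partial>lborel \<partial>lborel)"
    by (rule lborel_pair.Fubini') measurable
  also have "\<dots> = (\<integral>\<^sup>+ x. \<integral>\<^sup>+ y. \<phi> (f y - x) * g (f y) \<partial>lborel \<partial>lborel)"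
  proof (rule nn_integral_cong)
    fix x
    obtain z where z: "x = f z"
      using surj by blast
    have "(\<integral>\<^sup>+ y. \<phi> (f y) * g (f y + x) \<partial>lborel)
        = (\<integral>\<^sup>+ y. \<phi> (f (- z + y)) * g (f (- z + y) + x) \<partial>lborel)"
      by (rule nn_integral_lborel_add[symmetric]) measurable
    then show "(\<integral>\<^sup>+ y. \<phi> (f y) * g (f y + x) \<partial>lborel) = (\<integral>\<^sup>+ y. \<phi> (f y - x) * g (f y) \<partial>lborel)"
      by (simp add: diff z)
  qed
  also have "\<dots> = (\<integral>\<^sup>+ y. \<integral>\<^sup>+ x. \<phi> (f y - x) * g (f y) \<partial>lborel \<partial>lborel)"
    by (rule lborel_pair.Fubini') measurable
  also have "\<dots> = (\<integral>\<^sup>+ y. (\<integral>\<^sup>+ x. \<phi> (- f y + x) \<partial>lborel) * g (f y) \<partial>lborel)"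
  proof (rule nn_integral_cong)
    fix y
    have "\<phi> (f y - x) = \<phi> (- f y + x)" for x
      using \<phi>m[of "f y - x"] by (simp add: algebra_simps)
    then show "(\<integral>\<^sup>+ x. \<phi> (f y - x) * g (f y) \<partial>lborel) = (\<integral>\<^sup>+ x. \<phi> (- f y + x) \<partial>lborel) * g (f y)"
      by (simp add: nn_integral_multc)
  qed
  also have "\<dots> = I * (\<integral>\<^sup>+ y. g (f y) \<partial>lborel)"
    by (subst nn_integral_lborel_add) (simp_all add: I_def nn_integral_cmult)
  finally have "I * (\<integral>\<^sup>+ x. g x \<partial>lborel) = I * (\<integral>\<^sup>+ y. g (f y) \<partial>lborel)" .
  moreover have "0 < I" "I < \<infinity>"
    unfolding I by simp_all
  ultimately show ?thesis
    by (auto simp: ennreal_mult_cancel_left)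
qed

text \<open>The reflection in the hyperplane bisecting $a$ and $b$.  It is used instead of an arbitrary rotation
  because it is its own inverse.\<close>
lemma reflection_exists:
  fixes a b :: "'a::euclidean_space"
  assumes "norm a = 1" "norm b = 1"
  obtains f where "linear f" "\<And>x y. f x \<bullet> f y = x \<bullet> y" "\<And>x. f (f x) = x" "f a = b"
proof (cases "a = b")
  case True
  then show ?thesis using that[of "\<lambda>x. x"] by (simp add: linear_id[unfolded id_def])
next
  case False
  define w where "w = a - b"
  have w: "w \<bullet> w \<noteq> 0" using False by (simp add: w_def)
  define f where "f x = x - (2 * (x \<bullet> w) / (w \<bullet> w)) *\<^sub>R w" for x
  show ?thesis
  proof (rule that[of f])
    show "linear f"
      by (rule linearI)
        (simp_all add: f_def inner_add_left scaleR_add_left scaleR_diff_right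
          distrib_left add_divide_distrib)
    show ip: "f x \<bullet> f y = x \<bullet> y" for x y
    proof -
      have "f x \<bullet> f y = x \<bullet> y - 2 * (2 * (x \<bullet> w) * (y \<bullet> w) / (w \<bullet> w))
          + 4 * (x \<bullet> w) * (y \<bullet> w) / (w \<bullet> w) * ((w \<bullet> w) / (w \<bullet> w))"
        by (simp add: f_def inner_diff_left inner_diff_right inner_commute)
      also have "(w \<bullet> w) / (w \<bullet> w) = 1" using w by simp
      finally show ?thesis by simp
    qed
    show "f (f x) = x" for x
    proof -
      have "f x \<bullet> w = - (x \<bullet> w)"
        using w by (simp add: f_def inner_diff_left)
      then show ?thesis by (simp add: f_def[of "f x"]) (simp add: f_def)
    qed
    have "a \<bullet> a = 1" "b \<bullet> b = 1"
      using assms by (simp_all add: norm_eq_1)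
    then have "2 * (a \<bullet> w) = w \<bullet> w"
      by (simp add: w_def inner_diff_left inner_diff_right inner_commute)
    then have "f a = a - w" using w by (simp add: f_def)
    then show "f a = b" by (simp add: w_def)
  qed
qed

section \<open>The mass of the singular kernel beyond a hyperplane\<close>

definition singular_kernel :: "real \<Rightarrow> 'a::euclidean_space \<Rightarrow> ennreal" where
  "singular_kernel s h = ennreal (1 / norm h powr (real DIM('a) + s))"

lemma singular_kernel_measurable [measurable]: "singular_kernel s \<in> borel_measurable borel"
  unfolding singular_kernel_def by measurable

lemma singular_kernel_uminus: "singular_kernel s (- h) = singular_kernel s h"
  by (simp add: singular_kernel_def)

text \<open>Polar coordinates for radial functions: the image of Lebesgue measure under the Euclidean norm
  is determined by the volumes of balls.  It is stated on a product indexed by a finite set because it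
  is applied to the coordinates other than a given one, for which there is no type.\<close>
lemma nn_integral_radial_PiM:
  fixes A :: "'b set" and \<psi> :: "real \<Rightarrow> ennreal"
  assumes A: "finite A" "A \<noteq> {}" and [measurable]: "\<psi> \<in> borel_measurable borel"
  shows "(\<integral>\<^sup>+ f. \<psi> (sqrt (\<Sum>i\<in>A. (f i)\<^sup>2)) \<partial>Pi\<^sub>M A (\<lambda>_. lborel)) =
    (\<integral>\<^sup>+ t. ennreal (real (card A) * unit_ball_vol (real (card A)) * t ^ (card A - 1)) * indicator {0..} t * \<psi> t \<partial>lborel)"
proof -
  let ?M = "Pi\<^sub>M A (\<lambda>_. lborel :: real measure)"
  define n where "n = card A"
  have n: "n \<ge> 1" using A by (simp add: n_def Suc_leI card_gt_0_iff)
  define \<omega> where "\<omega> = unit_ball_vol (real n)"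
  have \<omega>: "0 \<le> \<omega>" by (simp add: \<omega>_def)
  define \<rho> where "\<rho> f = sqrt (\<Sum>i\<in>A. (f i)\<^sup>2)" for f :: "'b \<Rightarrow> real"
  have [measurable]: "\<rho> \<in> borel_measurable ?M"
    unfolding \<rho>_def by measurable
  define g where "g t = ennreal (real n * \<omega> * t ^ (n - 1)) * indicator {0..} t" for t :: real
  have [measurable]: "g \<in> borel_measurable borel" unfolding g_def by measurable
  have \<rho>0: "0 \<le> \<rho> f" for f by (simp add: \<rho>_def sum_nonneg)
  have pos: "emeasure (distr ?M borel \<rho>) {..a} = ennreal (\<omega> * a ^ n)" if "0 < a" for a
  proof -
    have "\<rho> -` {..a} \<inter> space ?M = {f. sqrt (\<Sum>i\<in>A. (f i)\<^sup>2) \<le> a} \<inter> space ?M"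
      by (auto simp: \<rho>_def)
    then show ?thesis
      using emeasure_cball_aux[OF A(1) that] by (simp add: emeasure_distr n_def \<omega>_def)
  qed
  have eq: "emeasure (distr ?M borel \<rho>) {..a} = emeasure (density lborel g) {..a}" for a
  proof -
    consider "a < 0" | "a = 0" | "0 < a" by linarith
    then show ?thesis
    proof cases
      case 1
      then have e: "\<rho> -` {..a} = {}" by (auto dest: order_trans[OF \<rho>0])
      have z: "(\<lambda>x. g x * indicator {..a} x) = (\<lambda>_. 0)"
        using 1 by (auto simp: g_def indicator_def)
      have "emeasure (density lborel g) {..a} = (\<integral>\<^sup>+ x. g x * indicator {..a} x \<partial>lborel)"
        by (rule emeasure_density) simp_all
      then show ?thesis unfolding z by (simp add: emeasure_distr e)
    next
      case 2
      \<comment> \<open>The volume formula is available for positive radii only; the origin is a limit of balls.\<close>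
      have "emeasure (distr ?M borel \<rho>) {..a} \<le> 0"
      proof (rule tendsto_lowerbound)
        show "((\<lambda>t. ennreal (\<omega> * t ^ n)) \<longlongrightarrow> 0) (at_right 0)"
          using n by (auto intro!: tendsto_eq_intros simp: power_0_left)
        show "\<forall>\<^sub>F t in at_right 0. emeasure (distr ?M borel \<rho>) {..a} \<le> ennreal (\<omega> * t ^ n)"
          unfolding eventually_at_filter
        proof (intro always_eventually allI impI)
          fix t :: real assume "t \<noteq> 0" "t \<in> {0<..}"
          then have "emeasure (distr ?M borel \<rho>) {..a} \<le> emeasure (distr ?M borel \<rho>) {..t}"
            using 2 by (intro emeasure_mono) auto
          then show "emeasure (distr ?M borel \<rho>) {..a} \<le> ennreal (\<omega> * t ^ n)"
            using pos[of t] \<open>t \<in> {0<..}\<close> by simp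
        qed
      qed simp
      moreover have "emeasure (density lborel g) {..a} = 0"
      proof -
        have "emeasure (density lborel g) {..a} = (\<integral>\<^sup>+ x. g x * indicator {..a} x \<partial>lborel)"
          by (rule emeasure_density) simp_all
        also have "\<dots> = (\<integral>\<^sup>+ x. 0 \<partial>(lborel :: real measure))"
        proof (rule nn_integral_cong_AE)
          show "AE x in lborel. g x * indicator {..a} x = 0"
            using AE_lborel_singleton[of "0::real"]
            by eventually_elim (use 2 in \<open>auto simp: g_def indicator_def\<close>)
        qed
        finally show ?thesis by simp
      qed
      ultimately show ?thesis by simp
    next
      case 3
      have "emeasure (density lborel g) {..a} = (\<integral>\<^sup>+ x. g x * indicator {..a} x \<partial>lborel)"
        by (rule emeasure_density) simp_all
      also have "\<dots> = (\<integral>\<^sup>+ x. ennreal (real n * \<omega> * x ^ (n - 1)) * indicator {0..a} x \<partial>lborel)"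
        by (intro nn_integral_cong) (auto simp: g_def indicator_def)
      also have "\<dots> = ennreal (\<omega> * a ^ n - \<omega> * 0 ^ n)"
        using 3 \<omega> by (intro nn_integral_FTC_Icc) (auto intro!: derivative_eq_intros)
      finally show ?thesis using pos[OF 3] n by (simp add: power_0_left)
    qed
  qed
  have "distr ?M borel \<rho> = density lborel g"
  proof (rule measure_eqI_generator_eq[where \<Omega>=UNIV and E="range (\<lambda>a. {..a})" and A="\<lambda>i. {..real i}"])
    show "Int_stable (range (\<lambda>a::real. {..a}))"
    proof (rule Int_stableI_image)
      fix a b :: real
      show "\<exists>c\<in>UNIV. {..a} \<inter> {..b} = {..c}" by (intro bexI[of _ "min a b"]) auto
    qed
    show "sets (distr ?M borel \<rho>) = sigma_sets UNIV (range (\<lambda>a. {..a}))"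
      by (simp add: borel_eq_atMost)
    show "sets (density lborel g) = sigma_sets UNIV (range (\<lambda>a. {..a}))"
      by (simp add: borel_eq_atMost)
    show "(\<Union>i. {..real i}) = UNIV" using real_arch_simple by auto
    show "emeasure (distr ?M borel \<rho>) {..real i} \<noteq> \<infinity>" for i
    proof -
      have "emeasure (distr ?M borel \<rho>) {..real i} \<le> emeasure (distr ?M borel \<rho>) {..real (Suc i)}"
        by (intro emeasure_mono) auto
      also have "\<dots> = ennreal (\<omega> * real (Suc i) ^ n)" by (rule pos) simp
      also have "\<dots> < \<infinity>" by simp
      finally show ?thesis by simp
    qed
  qed (use eq in auto)
  then have "(\<integral>\<^sup>+ t. \<psi> t \<partial>distr ?M borel \<rho>) = (\<integral>\<^sup>+ t. \<psi> t \<partial>density lborel g)" by simp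
  then show ?thesis
    by (simp add: nn_integral_distr nn_integral_density g_def \<rho>_def n_def \<omega>_def)
qed

lemma C_const_1: "C_const (Suc 0) q = 1"
  by (simp add: C_const_def)

text \<open>The integral that defines the constant converges, so that it equals the corresponding integral in
  the extended nonnegative reals: since $t \le \sqrt{1+t^2}$, the integrand is at most
  $1/(1+t^2)$.\<close>
lemma C_const_nn_integral:
  assumes N: "2 \<le> N" and q: "0 \<le> q"
  shows "ennreal (C_const N q) = (\<integral>\<^sup>+ t. ennreal (real (N - 1) * unit_ball_vol (real (N - 1)) * t ^ (N - 2))
      * indicator {0..} t * ennreal (1 / sqrt (1 + t\<^sup>2) powr (real N + q)) \<partial>lborel)"
    and "0 \<le> C_const N q"
proof -
  let ?f = "\<lambda>t::real. t ^ (N - 2) / (1 + t\<^sup>2) powr ((real N + q) / 2)"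
  have sq: "sqrt (1 + t\<^sup>2) powr p = (1 + t\<^sup>2) powr (p / 2)" for t p :: real
    by (simp add: powr_half_sqrt[symmetric] powr_powr)
  have nn: "0 \<le> indicator {0<..} t * ?f t" for t :: real by (auto simp: indicator_def)
  have le: "?f t \<le> inverse (1 + t\<^sup>2)" if "0 \<le> t" for t :: real
  proof -
    have "t \<le> sqrt (1 + t\<^sup>2)" by (rule real_le_rsqrt) simp
    then have "t ^ (N - 2) \<le> sqrt (1 + t\<^sup>2) ^ (N - 2)" using that by (intro power_mono)
    also have "\<dots> = (1 + t\<^sup>2) powr ((real N - 2) / 2)"
      using N sq[of t "real (N - 2)"]
      by (subst (asm) powr_realpow) (auto simp: of_nat_diff intro!: add_pos_nonneg)
    also have "\<dots> \<le> (1 + t\<^sup>2) powr ((real N + q) / 2 - 1)"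
      using q by (intro powr_mono) (auto simp: field_simps)
    finally have "?f t \<le> (1 + t\<^sup>2) powr ((real N + q) / 2 - 1) / (1 + t\<^sup>2) powr ((real N + q) / 2)"
      by (intro divide_right_mono) auto
    also have "\<dots> = (1 + t\<^sup>2) powr (-1)" by (simp add: powr_diff[symmetric])
    also have "\<dots> = inverse (1 + t\<^sup>2)" by (simp add: powr_minus add_nonneg_nonneg)
    finally show ?thesis .
  qed
  have "(\<integral>\<^sup>+ t. ennreal (indicator {0<..} t * ?f t) \<partial>lborel)
      \<le> (\<integral>\<^sup>+ t. ennreal (inverse (1 + t\<^sup>2)) * indicator {0..} t \<partial>lborel)"
    using le by (intro nn_integral_mono) (auto simp: indicator_def ennreal_leI)
  also have "\<dots> = ennreal (pi / 2 - arctan 0)"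
    by (rule nn_integral_FTC_atLeast[where F=arctan])
      (auto intro!: DERIV_arctan tendsto_arctan_at_top add_nonneg_nonneg)
  finally have fin: "(\<integral>\<^sup>+ t. ennreal (indicator {0<..} t * ?f t) \<partial>lborel) < \<infinity>"
    by (simp add: le_less_trans)
  have I: "ennreal (LBINT t:{0<..}. ?f t) = (\<integral>\<^sup>+ t. ennreal (indicator {0<..} t * ?f t) \<partial>lborel)"
    unfolding set_lebesgue_integral_def real_scaleR_def
    using nn fin by (subst integral_eq_nn_integral) auto
  have c: "0 \<le> real (N - 1) * unit_ball_vol (real (N - 1))" by simp
  have I0: "0 \<le> (LBINT t:{0<..}. ?f t)"
    unfolding set_lebesgue_integral_def real_scaleR_def by (intro integral_nonneg_AE) (use nn in auto)
  have C: "C_const N q = real (N - 1) * unit_ball_vol (real (N - 1)) * (LBINT t:{0<..}. ?f t)"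
    using N by (simp add: C_const_def of_nat_diff)
  show "0 \<le> C_const N q" unfolding C using I0 c by simp
  have "ennreal (C_const N q) = ennreal (real (N - 1) * unit_ball_vol (real (N - 1))) *
      (\<integral>\<^sup>+ t. ennreal (indicator {0<..} t * ?f t) \<partial>lborel)"
    unfolding C ennreal_mult[OF c I0] I ..
  also have "\<dots> = (\<integral>\<^sup>+ t. ennreal (real (N - 1) * unit_ball_vol (real (N - 1))) *
      ennreal (indicator {0<..} t * ?f t) \<partial>lborel)"
    by (rule nn_integral_cmult[symmetric]) measurable
  also have "\<dots> = (\<integral>\<^sup>+ t. ennreal (real (N - 1) * unit_ball_vol (real (N - 1)) * t ^ (N - 2))
      * indicator {0..} t * ennreal (1 / sqrt (1 + t\<^sup>2) powr (real N + q)) \<partial>lborel)"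
  proof (rule nn_integral_cong_AE, use AE_lborel_singleton[of "0::real"] in eventually_elim)
    case (elim t)
    then show ?case using c
      by (auto simp: indicator_def sq ennreal_mult[symmetric])
  qed
  finally show "ennreal (C_const N q) = \<dots>" .
qed

lemma C_const_pos:
  assumes "1 \<le> N" "0 \<le> q" shows "0 < C_const N q"
proof (cases "N = 1")
  case False
  then have N: "2 \<le> N" using assms by simp
  define c where "c = real (N - 1) * unit_ball_vol (real (N - 1))"
  have c: "0 < c" unfolding c_def using N by (intro mult_pos_pos unit_ball_vol_pos) auto
  have "C_const N q \<noteq> 0"
  proof
    assume "C_const N q = 0"
    then have "(\<integral>\<^sup>+ t. ennreal (c * t ^ (N - 2)) * indicator {0..} t *
        ennreal (1 / sqrt (1 + t\<^sup>2) powr (real N + q)) \<partial>lborel) = 0"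
      using C_const_nn_integral(1)[OF N assms(2), folded c_def] by simp
    then have "AE t in lborel. ennreal (c * t ^ (N - 2)) * indicator {0..} t *
        ennreal (1 / sqrt (1 + t\<^sup>2) powr (real N + q)) = 0"
      by (subst (asm) nn_integral_0_iff_AE) auto
    then have "AE t in lborel. t \<notin> {0<..<1::real}"
    proof eventually_elim
      case (elim t)
      show ?case
      proof
        assume t: "t \<in> {0<..<1}"
        have "0 < 1 + t\<^sup>2" by (simp add: add_pos_nonneg)
        then have "0 < 1 / sqrt (1 + t\<^sup>2) powr (real N + q)" by simp
        moreover have "0 < c * t ^ (N - 2)" using t c by simp
        ultimately show False
          using elim t by (auto simp: ennreal_eq_0_iff)
      qed
    qed
    then have "emeasure lborel {0<..<1::real} = 0"
      using AE_iff_measurable[of "{0<..<1::real}" lborel "\<lambda>t. t \<notin> {0<..<1}"] by (auto simp: set_eq_iff)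
    then show False by simp
  qed
  then show ?thesis using C_const_nn_integral(2)[OF N assms(2)] by simp
qed (simp add: C_const_def)

text \<open>This is where $C_{N,s}$ comes from: the integral of the kernel over the affine hyperplane at
  height $r$.  Polar coordinates in the $N-1$ remaining directions and the substitution
  $t \mapsto rt$ reduce it to the defining integral; for $N = 1$ the hyperplane is a point.\<close>
lemma kernel_fibre_integral:
  fixes e :: "'a::euclidean_space"
  assumes e: "e \<in> Basis" and r: "0 < r" and s: "0 \<le> s"
  shows "(\<integral>\<^sup>+ f. ennreal (1 / sqrt (r\<^sup>2 + (\<Sum>b\<in>Basis - {e}. (f b)\<^sup>2)) powr (real DIM('a) + s))
      \<partial>Pi\<^sub>M (Basis - {e}) (\<lambda>_. lborel)) = ennreal (C_const DIM('a) s * r powr (- 1 - s))"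
proof (cases "DIM('a) = 1")
  case True
  then have "Basis = {e}" using e by (metis card_1_singletonE singletonD)
  then have B: "Basis - {e} = {}" by auto
  interpret product_sigma_finite "\<lambda>_::'a. lborel :: real measure" by standard
  show ?thesis
    using r True by (simp add: B PiM_empty nn_integral_count_space_finite C_const_1 powr_minus_divide[symmetric])
next
  case False
  let ?N = "DIM('a)" and ?A = "Basis - {e} :: 'a set"
  have N: "2 \<le> ?N" using False DIM_positive[where 'a='a] by linarith
  have card: "card ?A = ?N - 1" using e by (simp add: card_Diff_singleton)
  have "card ?A \<noteq> 0" using card N by simp
  then have ne: "?A \<noteq> {}" by auto
  let ?c = "real (?N - 1) * unit_ball_vol (real (?N - 1))"
  have c: "0 \<le> ?c" by simp
  let ?\<psi> = "\<lambda>t. ennreal (1 / sqrt (r\<^sup>2 + t\<^sup>2) powr (real ?N + s))"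
  have "(\<integral>\<^sup>+ f. ennreal (1 / sqrt (r\<^sup>2 + (\<Sum>b\<in>?A. (f b)\<^sup>2)) powr (real ?N + s)) \<partial>Pi\<^sub>M ?A (\<lambda>_. lborel))
      = (\<integral>\<^sup>+ f. ?\<psi> (sqrt (\<Sum>b\<in>?A. (f b)\<^sup>2)) \<partial>Pi\<^sub>M ?A (\<lambda>_. lborel))"
    by (simp add: sum_nonneg)
  also have "\<dots> = (\<integral>\<^sup>+ t. ennreal (?c * t ^ (?N - 2)) * indicator {0..} t * ?\<psi> t \<partial>lborel)"
    by (subst nn_integral_radial_PiM[OF _ ne]) (auto simp: card numeral_2_eq_2)
  also have "\<dots> = ennreal \<bar>r\<bar> * (\<integral>\<^sup>+ t. ennreal (?c * (0 + r * t) ^ (?N - 2)) * indicator {0..} (0 + r * t) * ?\<psi> (0 + r * t) \<partial>lborel)"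
    using r by (intro nn_integral_real_affine) auto
  also have "\<dots> = (\<integral>\<^sup>+ t. ennreal \<bar>r\<bar> * (ennreal (?c * (0 + r * t) ^ (?N - 2)) * indicator {0..} (0 + r * t) * ?\<psi> (0 + r * t)) \<partial>lborel)"
    by (rule nn_integral_cmult[symmetric]) measurable
  also have "\<dots> = (\<integral>\<^sup>+ t. ennreal (r powr (- 1 - s)) * (ennreal (?c * t ^ (?N - 2)) * indicator {0..} t *
      ennreal (1 / sqrt (1 + t\<^sup>2) powr (real ?N + s))) \<partial>lborel)"
  proof (rule nn_integral_cong)
    fix t :: real
    show "ennreal \<bar>r\<bar> * (ennreal (?c * (0 + r * t) ^ (?N - 2)) * indicator {0..} (0 + r * t) * ?\<psi> (0 + r * t))
      = ennreal (r powr (- 1 - s)) * (ennreal (?c * t ^ (?N - 2)) * indicator {0..} t *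
        ennreal (1 / sqrt (1 + t\<^sup>2) powr (real ?N + s)))"
    proof (cases "0 \<le> t")
      case t: True
      have "sqrt (r\<^sup>2 + (r * t)\<^sup>2) = r * sqrt (1 + t\<^sup>2)"
      proof -
        have "r\<^sup>2 + (r * t)\<^sup>2 = r\<^sup>2 * (1 + t\<^sup>2)" by (simp add: algebra_simps power_mult_distrib)
        then show ?thesis using r by (simp add: real_sqrt_mult)
      qed
      then have p: "sqrt (r\<^sup>2 + (r * t)\<^sup>2) powr (real ?N + s) = r powr (real ?N + s) * sqrt (1 + t\<^sup>2) powr (real ?N + s)"
        using r by (simp add: powr_mult)
      have "r * r ^ (?N - 2) / r powr (real ?N + s) = r powr (1 + real (?N - 2) - (real ?N + s))"
        using r by (simp add: powr_diff powr_add powr_realpow)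
      also have "1 + real (?N - 2) - (real ?N + s) = - 1 - s" using N by (simp add: of_nat_diff)
      finally have q: "r * r ^ (?N - 2) / r powr (real ?N + s) = r powr (- 1 - s)" .
      have "\<bar>r\<bar> * (?c * (0 + r * t) ^ (?N - 2) * (1 / sqrt (r\<^sup>2 + (0 + r * t)\<^sup>2) powr (real ?N + s)))
        = (r * r ^ (?N - 2) / r powr (real ?N + s)) * (?c * t ^ (?N - 2) * (1 / sqrt (1 + t\<^sup>2) powr (real ?N + s)))"
        unfolding add_0 p using r by (simp add: power_mult_distrib)
      then show ?thesis
        using r t c unfolding q by (simp add: ennreal_mult[symmetric] del: times_divide_eq_right)
    next
      case False
      then show ?thesis using r by (simp add: indicator_def zero_le_mult_iff)
    qed
  qed
  also have "\<dots> = ennreal (r powr (- 1 - s)) * ennreal (C_const ?N s)"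
    unfolding C_const_nn_integral(1)[OF N s] by (rule nn_integral_cmult) measurable
  also have "\<dots> = ennreal (C_const ?N s * r powr (- 1 - s))"
    using C_const_nn_integral(2)[OF N s] by (simp add: ennreal_mult[symmetric] mult.commute)
  finally show ?thesis .
qed

lemma kernel_half_space_Basis:
  fixes e :: "'a::euclidean_space"
  assumes e: "e \<in> Basis" and t: "0 < t" and s: "0 < s"
  shows "(\<integral>\<^sup>+ h. indicator {h. t \<le> h \<bullet> e} h * singular_kernel s h \<partial>lborel)
    = ennreal (C_const DIM('a) s / s * t powr (- s))"
proof -
  interpret product_sigma_finite "\<lambda>_::'a. lborel :: real measure" by standard
  let ?A = "Basis - {e} :: 'a set"
  let ?C = "C_const DIM('a) s"
  have B: "Basis = insert e ?A" using e by auto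
  have C: "0 < ?C" using s by (intro C_const_pos) (auto simp: Suc_leI)
  define \<Phi> where "\<Phi> f = (\<Sum>b\<in>Basis. f b *\<^sub>R b :: 'a)" for f :: "'a \<Rightarrow> real"
  have [measurable]: "\<Phi> \<in> borel_measurable (Pi\<^sub>M Basis (\<lambda>_. lborel))"
    unfolding \<Phi>_def by measurable
  define G where "G h = indicator {h. t \<le> h \<bullet> e} h * singular_kernel s h" for h :: 'a
  have [measurable]: "G \<in> borel_measurable borel" unfolding G_def by measurable
  have inn: "\<Phi> f \<bullet> b = f b" if "b \<in> Basis" for f b
    using that by (simp add: \<Phi>_def inner_sum_left_Basis)
  have nrm: "norm (\<Phi> (f(e := r))) = sqrt (r\<^sup>2 + (\<Sum>b\<in>?A. (f b)\<^sup>2))" for f r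
  proof -
    have "norm (\<Phi> (f(e := r))) = sqrt (\<Sum>b\<in>Basis. ((f(e := r)) b)\<^sup>2)"
      by (subst euclidean_dist_l2[of _ 0, unfolded dist_0_norm L2_set_def dist_norm, simplified]) (simp add: inn)
    also have "(\<Sum>b\<in>Basis. ((f(e := r)) b)\<^sup>2) = r\<^sup>2 + (\<Sum>b\<in>?A. ((f(e := r)) b)\<^sup>2)"
      by (subst sum.remove[OF _ e]) auto
    also have "(\<Sum>b\<in>?A. ((f(e := r)) b)\<^sup>2) = (\<Sum>b\<in>?A. (f b)\<^sup>2)"
      by (intro sum.cong) auto
    finally show ?thesis .
  qed
  have "(\<integral>\<^sup>+ h. G h \<partial>lborel) = (\<integral>\<^sup>+ f. G (\<Phi> f) \<partial>Pi\<^sub>M Basis (\<lambda>_. lborel))"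
    unfolding \<Phi>_def[abs_def] by (subst lborel_eq) (simp add: nn_integral_distr)
  also have "\<dots> = (\<integral>\<^sup>+ r. (\<integral>\<^sup>+ f. G (\<Phi> (f(e := r))) \<partial>Pi\<^sub>M ?A (\<lambda>_. lborel)) \<partial>lborel)"
    using product_nn_integral_insert_rev[of ?A e "\<lambda>f. G (\<Phi> f)"] B by (auto simp flip: B)
  also have "\<dots> = (\<integral>\<^sup>+ r. ennreal (?C * r powr (- 1 - s)) * indicator {t..} r \<partial>lborel)"
  proof (rule nn_integral_cong)
    fix r :: real
    show "(\<integral>\<^sup>+ f. G (\<Phi> (f(e := r))) \<partial>Pi\<^sub>M ?A (\<lambda>_. lborel)) = ennreal (?C * r powr (- 1 - s)) * indicator {t..} r"
    proof (cases "t \<le> r")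
      case True
      then have "0 < r" using t by simp
      from kernel_fibre_integral[OF e this less_imp_le[OF s]] True show ?thesis
        by (simp add: G_def singular_kernel_def nrm inn e)
    qed (simp add: G_def inn e)
  qed
  also have "\<dots> = ennreal (0 - (- ?C / s * t powr (- s)))"
  proof (rule nn_integral_FTC_atLeast)
    show "((\<lambda>r. - ?C / s * r powr (- s)) has_real_derivative ?C * x powr (- 1 - s)) (at x)" if "t \<le> x" for x
      using that t s by (auto intro!: derivative_eq_intros simp: powr_diff field_simps powr_minus)
    have "((\<lambda>r. r powr (- s)) \<longlongrightarrow> 0) at_top"
      using s by (intro tendsto_neg_powr filterlim_ident) auto
    from tendsto_mult_right_zero[OF this] show "((\<lambda>r. - ?C / s * r powr (- s)) \<longlongrightarrow> 0) at_top" .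
  qed (use C in auto)
  finally show ?thesis by (simp add: G_def)
qed

text \<open>A reflection carries the coordinate direction of the previous lemma to the given one.\<close>
lemma kernel_half_space:
  fixes a :: "'a::euclidean_space"
  assumes a: "norm a = 1" and t: "0 < t" and s: "0 < s"
  shows "(\<integral>\<^sup>+ h. indicator {h. t \<le> h \<bullet> a} h * singular_kernel s h \<partial>lborel)
    = ennreal (C_const DIM('a) s / s * t powr (- s))"
proof -
  obtain e :: 'a where e: "e \<in> Basis" using nonempty_Basis by blast
  obtain f where f: "linear f" "\<And>x y. f x \<bullet> f y = x \<bullet> y" "f e = a"
    using reflection_exists[of e a] e a by (metis norm_Basis)
  have nf: "norm (f x) = norm x" for x by (simp add: norm_eq_sqrt_inner f)
  have "(\<integral>\<^sup>+ h. indicator {h. t \<le> h \<bullet> a} h * singular_kernel s h \<partial>lborel)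
      = (\<integral>\<^sup>+ h. indicator {h. t \<le> h \<bullet> a} (f h) * singular_kernel s (f h) \<partial>lborel)"
    by (rule nn_integral_lborel_isometry[OF f(1) nf, symmetric]) measurable
  also have "\<dots> = (\<integral>\<^sup>+ h. indicator {h. t \<le> h \<bullet> e} h * singular_kernel s h \<partial>lborel)"
    by (simp add: f(2) f(3)[symmetric] singular_kernel_def nf indicator_def)
  finally show ?thesis using kernel_half_space_Basis[OF e t s] by simp
qed

section \<open>The seminorm as an integral of translation differences\<close>

definition shift_diff :: "('a::euclidean_space \<Rightarrow> real) \<Rightarrow> 'a \<Rightarrow> ennreal" where
  "shift_diff u h = (\<integral>\<^sup>+ x. ennreal \<bar>u x - u (x + h)\<bar> \<partial>lborel)"

lemma shift_diff_measurable [measurable]: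
  assumes [measurable]: "u \<in> borel_measurable borel"
  shows "shift_diff u \<in> borel_measurable borel"
  unfolding shift_diff_def by measurable

lemma gagliardo_eq_shift_diff:
  fixes u :: "'a::euclidean_space \<Rightarrow> real"
  assumes [measurable]: "u \<in> borel_measurable borel"
  shows "gagliardo s u = (\<integral>\<^sup>+ h. singular_kernel s h * shift_diff u h \<partial>lborel)"
proof -
  have "gagliardo s u = (\<integral>\<^sup>+ x. (\<integral>\<^sup>+ h. singular_kernel s h * ennreal \<bar>u x - u (x + h)\<bar> \<partial>lborel) \<partial>lborel)"
    unfolding gagliardo_def
  proof (rule nn_integral_cong)
    fix x :: 'a
    have "(\<integral>\<^sup>+ y. ennreal (\<bar>u x - u y\<bar> / norm (x - y) powr (real DIM('a) + s)) \<partial>lborel)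
      = (\<integral>\<^sup>+ h. ennreal (\<bar>u x - u (x + h)\<bar> / norm (x - (x + h)) powr (real DIM('a) + s)) \<partial>lborel)"
      by (rule nn_integral_lborel_add[symmetric]) measurable
    then show "(\<integral>\<^sup>+ y. ennreal (\<bar>u x - u y\<bar> / norm (x - y) powr (real DIM('a) + s)) \<partial>lborel)
      = (\<integral>\<^sup>+ h. singular_kernel s h * ennreal \<bar>u x - u (x + h)\<bar> \<partial>lborel)"
      by (simp add: singular_kernel_def ennreal_mult[symmetric])
  qed
  also have "\<dots> = (\<integral>\<^sup>+ h. (\<integral>\<^sup>+ x. singular_kernel s h * ennreal \<bar>u x - u (x + h)\<bar> \<partial>lborel) \<partial>lborel)"
    by (rule lborel_pair.Fubini') measurable
  also have "\<dots> = (\<integral>\<^sup>+ h. singular_kernel s h * shift_diff u h \<partial>lborel)"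
    unfolding shift_diff_def by (rule nn_integral_cong, rule nn_integral_cmult) measurable
  finally show ?thesis .
qed

lemma shift_diff_shifted:
  fixes u :: "'a::euclidean_space \<Rightarrow> real"
  assumes [measurable]: "u \<in> borel_measurable borel"
  shows "(\<integral>\<^sup>+ x. ennreal \<bar>u (c + x) - u (c + x + h)\<bar> \<partial>lborel) = shift_diff u h"
  unfolding shift_diff_def by (rule nn_integral_lborel_add) measurable

lemma shift_diff_0 [simp]: "shift_diff u 0 = 0"
  by (simp add: shift_diff_def)

lemma shift_diff_uminus:
  assumes "u \<in> borel_measurable borel"
  shows "shift_diff u (- h) = shift_diff u h"
  using shift_diff_shifted[OF assms, of "- h" h]
  by (simp add: shift_diff_def abs_minus_commute algebra_simps)

lemma shift_diff_add:
  assumes [measurable]: "u \<in> borel_measurable borel"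
  shows "shift_diff u (h + k) \<le> shift_diff u h + shift_diff u k"
proof -
  have "shift_diff u (h + k) \<le> (\<integral>\<^sup>+ x. ennreal \<bar>u x - u (x + h)\<bar> + ennreal \<bar>u (h + x) - u (h + x + k)\<bar> \<partial>lborel)"
    unfolding shift_diff_def
    by (intro nn_integral_mono) (auto simp: ennreal_plus[symmetric] ac_simps intro!: ennreal_leI simp del: ennreal_plus)
  also have "\<dots> = shift_diff u h + (\<integral>\<^sup>+ x. ennreal \<bar>u (h + x) - u (h + x + k)\<bar> \<partial>lborel)"
    unfolding shift_diff_def by (rule nn_integral_add) measurable
  finally show ?thesis by (simp only: shift_diff_shifted[OF assms])
qed

lemma shift_diff_sum:
  assumes "u \<in> borel_measurable borel" "finite I"
  shows "shift_diff u (\<Sum>i\<in>I. k i) \<le> (\<Sum>i\<in>I. shift_diff u (k i))"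
  using assms(2)
proof (induction I)
  case (insert i I)
  have "shift_diff u (k i + (\<Sum>i\<in>I. k i)) \<le> shift_diff u (k i) + shift_diff u (\<Sum>i\<in>I. k i)"
    by (rule shift_diff_add[OF assms(1)])
  also have "\<dots> \<le> shift_diff u (k i) + (\<Sum>i\<in>I. shift_diff u (k i))"
    by (intro add_left_mono insert.IH)
  finally show ?case using insert.hyps by simp
qed simp

lemma shift_diff_le_norm:
  fixes u :: "'a::euclidean_space \<Rightarrow> real"
  assumes [measurable]: "u \<in> borel_measurable borel"
  shows "shift_diff u h \<le> 2 * (\<integral>\<^sup>+ x. ennreal \<bar>u x\<bar> \<partial>lborel)"
proof -
  have "shift_diff u h \<le> (\<integral>\<^sup>+ x. ennreal \<bar>u x\<bar> + ennreal \<bar>u (h + x)\<bar> \<partial>lborel)"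
    unfolding shift_diff_def
    by (intro nn_integral_mono) (auto simp: ennreal_plus[symmetric] ac_simps intro!: ennreal_leI simp del: ennreal_plus)
  also have "\<dots> = (\<integral>\<^sup>+ x. ennreal \<bar>u x\<bar> \<partial>lborel) + (\<integral>\<^sup>+ x. ennreal \<bar>u (h + x)\<bar> \<partial>lborel)"
    by (rule nn_integral_add) measurable
  also have "(\<integral>\<^sup>+ x. ennreal \<bar>u (h + x)\<bar> \<partial>lborel) = (\<integral>\<^sup>+ x. ennreal \<bar>u x\<bar> \<partial>lborel)"
    by (rule nn_integral_lborel_add) measurable
  finally show ?thesis by (simp add: mult_2)
qed

lemma shift_diff_diff:
  assumes [measurable]: "u \<in> borel_measurable borel" "v \<in> borel_measurable borel"
  shows "shift_diff (\<lambda>x. u x - v x) h \<le> shift_diff u h + shift_diff v h"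
proof -
  have "shift_diff (\<lambda>x. u x - v x) h \<le> (\<integral>\<^sup>+ x. ennreal \<bar>u x - u (x + h)\<bar> + ennreal \<bar>v x - v (x + h)\<bar> \<partial>lborel)"
    unfolding shift_diff_def
    by (intro nn_integral_mono) (auto simp: ennreal_plus[symmetric] intro!: ennreal_leI simp del: ennreal_plus)
  also have "\<dots> = shift_diff u h + shift_diff v h"
    unfolding shift_diff_def by (rule nn_integral_add) measurable
  finally show ?thesis .
qed

lemma gagliardo_cmult:
  assumes [measurable]: "u \<in> borel_measurable borel"
  shows "gagliardo s (\<lambda>x. c * u x) = ennreal \<bar>c\<bar> * gagliardo s u"
proof -
  have "shift_diff (\<lambda>x. c * u x) h = ennreal \<bar>c\<bar> * shift_diff u h" for h
    unfolding shift_diff_def right_diff_distrib[symmetric] abs_mult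
    by (simp add: ennreal_mult nn_integral_cmult)
  then show ?thesis
    by (simp add: gagliardo_eq_shift_diff mult.left_commute nn_integral_cmult)
qed

section \<open>Distance to the boundary\<close>

lemma open_half_space: "open (half_space a)"
  using open_halfspace_gt[of 0 a] by (simp add: half_space_def inner_commute)

text \<open>The segment from a point inside to a point outside meets the boundary.\<close>
lemma boundary_dist_le_dist:
  assumes "x \<in> \<Omega>" "z \<notin> \<Omega>"
  shows "boundary_dist \<Omega> x \<le> dist x z"
proof -
  have "closed_segment x z \<inter> frontier \<Omega> \<noteq> {}"
    by (rule connected_Int_frontier) (use assms in auto)
  then obtain w where w: "w \<in> closed_segment x z" "w \<in> frontier \<Omega>" by blast
  have "boundary_dist \<Omega> x \<le> dist x w"
    unfolding boundary_dist_def by (rule infdist_le[OF w(2)])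
  also have "\<dots> \<le> dist x z"
    using dist_in_closed_segment[OF w(1)] by (simp add: dist_commute)
  finally show ?thesis .
qed

lemma boundary_dist_measurable [measurable]: "boundary_dist \<Omega> \<in> borel_measurable borel"
  unfolding boundary_dist_def[abs_def]
  by (intro borel_measurable_continuous_onI continuous_on_infdist continuous_on_id)

lemma nearest_boundary_point:
  assumes "open \<Omega>" "x \<in> \<Omega>" "\<Omega> \<noteq> UNIV"
  obtains p where "p \<in> frontier \<Omega>" "p \<notin> \<Omega>" "boundary_dist \<Omega> x = dist x p" "0 < boundary_dist \<Omega> x"
proof -
  have "frontier \<Omega> \<noteq> {}" using assms by (auto simp: frontier_eq_empty)
  then obtain p where p: "p \<in> frontier \<Omega>" "infdist x (frontier \<Omega>) = dist x p"
    using infdist_attains_inf[OF frontier_closed] by metis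
  have "p \<notin> \<Omega>" using p(1) assms(1) by (auto simp: frontier_def interior_open)
  moreover from this have "0 < dist x p" using assms(2) by auto
  ultimately show ?thesis using that p by (simp add: boundary_dist_def)
qed

lemma boundary_dist_half_space:
  assumes a: "norm a = 1" and x: "0 < x \<bullet> a"
  shows "boundary_dist (half_space a) x = x \<bullet> a"
proof (rule antisym)
  have aa: "a \<bullet> a = 1" using a by (simp add: norm_eq_1)
  have x': "x \<in> half_space a" using x by (simp add: half_space_def)
  have "boundary_dist (half_space a) x \<le> dist x (x - (x \<bullet> a) *\<^sub>R a)"
    by (rule boundary_dist_le_dist[OF x']) (simp add: half_space_def inner_diff_left aa)
  then show "boundary_dist (half_space a) x \<le> x \<bullet> a"
    using x a by (simp add: dist_norm)
  have "half_space a \<noteq> UNIV"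
  proof -
    have "0 \<notin> half_space a" by (simp add: half_space_def)
    then show ?thesis by auto
  qed
  then obtain p where p: "p \<notin> half_space a" "boundary_dist (half_space a) x = dist x p"
    using nearest_boundary_point[OF open_half_space x'] by metis
  have "x \<bullet> a \<le> (x - p) \<bullet> a" using p(1) by (simp add: half_space_def inner_diff_left)
  also have "\<dots> \<le> norm (x - p) * norm a" by (rule norm_cauchy_schwarz)
  finally show "x \<bullet> a \<le> boundary_dist (half_space a) x" using p(2) a by (simp add: dist_norm)
qed

lemma hardy_integral_half_space:
  fixes u :: "'a::euclidean_space \<Rightarrow> real"
  assumes a: "norm a = 1"
  shows "hardy_integral s (half_space a) u =
    (\<integral>\<^sup>+ x. ennreal (\<bar>u x\<bar> / (x \<bullet> a) powr s) * indicator {x. 0 < x \<bullet> a} x \<partial>lborel)"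
  unfolding hardy_integral_def
proof (rule nn_integral_cong)
  fix x :: 'a
  have "x \<in> half_space a \<longleftrightarrow> 0 < x \<bullet> a" by (simp add: half_space_def)
  then show "ennreal (\<bar>u x\<bar> / boundary_dist (half_space a) x powr s) * indicator (half_space a) x =
    ennreal (\<bar>u x\<bar> / (x \<bullet> a) powr s) * indicator {x. 0 < x \<bullet> a} x"
    by (cases "0 < x \<bullet> a") (simp_all add: boundary_dist_half_space[OF a])
qed

text \<open>Separation of $p$ from the convex set is weak at first; it becomes strict because the
  set is open.\<close>
lemma supporting_half_space:
  fixes \<Omega> :: "'a::euclidean_space set"
  assumes "open \<Omega>" "convex \<Omega>" "\<Omega> \<noteq> {}" "p \<notin> \<Omega>"
  obtains a where "norm a = 1" "\<And>y. y \<in> \<Omega> \<Longrightarrow> p \<bullet> a < y \<bullet> a"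
proof -
  obtain c b where c: "c \<noteq> 0" "\<forall>x\<in>{p}. c \<bullet> x \<le> b" "\<forall>x\<in>\<Omega>. b \<le> c \<bullet> x"
    using separating_hyperplane_sets[of "{p}" \<Omega>] assms by auto
  define a where "a = c /\<^sub>R norm c"
  have a: "norm a = 1" using c(1) by (simp add: a_def)
  have le: "p \<bullet> a \<le> y \<bullet> a" if "y \<in> \<Omega>" for y
  proof -
    have "c \<bullet> p \<le> c \<bullet> y" using c that by force
    then show ?thesis by (simp add: a_def inner_commute divide_right_mono divide_inverse mult_left_mono)
  qed
  show ?thesis
  proof (rule that[OF a])
    fix y assume y: "y \<in> \<Omega>"
    then obtain d where d: "0 < d" "ball y d \<subseteq> \<Omega>"
      using assms(1) open_contains_ball by metis
    have "y - (d / 2) *\<^sub>R a \<in> ball y d" using d(1) a by (simp add: dist_norm)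
    then have "p \<bullet> a \<le> (y - (d / 2) *\<^sub>R a) \<bullet> a" using d(2) le by blast
    then show "p \<bullet> a < y \<bullet> a"
      using d(1) a by (simp add: inner_diff_left norm_eq_1)
  qed
qed

section \<open>Lower bounds for the seminorm\<close>

text \<open>Let $M$ and $J$ be the masses of $|u|$ below and above the height $h \cdot a$.  On the
  half-space itself, $|u(x)| \le |u(x) - u(x+h)| + |u(x+h)|$ integrates to $M + J \le X + J$, where $X$ is
  the part of the translation difference over $x \cdot a > 0$; here $J$ is finite and
  cancels.  Below the half-space $u(x) = 0$, and the difference is exactly the mass $M$ that
  is moved there.\<close>

lemma half_space_shift_lower_bound:
  fixes u :: "'a::euclidean_space \<Rightarrow> real"
  assumes [measurable]: "u \<in> borel_measurable borel"
    and fin: "(\<integral>\<^sup>+ x. ennreal \<bar>u x\<bar> \<partial>lborel) < \<infinity>"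
    and supp: "\<And>x. x \<bullet> a \<le> 0 \<Longrightarrow> u x = 0"
  shows "2 * (\<integral>\<^sup>+ x. ennreal \<bar>u x\<bar> * indicator {x. x \<bullet> a \<le> h \<bullet> a} x \<partial>lborel) \<le> shift_diff u h"
proof -
  define M where "M = (\<integral>\<^sup>+ x. ennreal \<bar>u x\<bar> * indicator {x. x \<bullet> a \<le> h \<bullet> a} x \<partial>lborel)"
  define J where "J = (\<integral>\<^sup>+ x. ennreal \<bar>u x\<bar> * indicator {x. h \<bullet> a < x \<bullet> a} x \<partial>lborel)"
  define X where "X = (\<integral>\<^sup>+ x. ennreal \<bar>u x - u (x + h)\<bar> * indicator {x. 0 < x \<bullet> a} x \<partial>lborel)"
  define Y where "Y = (\<integral>\<^sup>+ x. ennreal \<bar>u x - u (x + h)\<bar> * indicator {x. x \<bullet> a \<le> 0} x \<partial>lborel)"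
  have MJ: "M + J = (\<integral>\<^sup>+ x. ennreal \<bar>u x\<bar> \<partial>lborel)"
    unfolding M_def J_def by (subst nn_integral_add[symmetric])
      (auto intro!: nn_integral_cong simp: indicator_def)
  have J: "J \<noteq> \<infinity>" using MJ fin by auto
  have "J = (\<integral>\<^sup>+ x. ennreal \<bar>u (h + x)\<bar> * indicator {x. h \<bullet> a < x \<bullet> a} (h + x) \<partial>lborel)"
    unfolding J_def by (rule nn_integral_lborel_add[symmetric]) measurable
  then have "X + J = (\<integral>\<^sup>+ x. ennreal \<bar>u x - u (x + h)\<bar> * indicator {x. 0 < x \<bullet> a} x +
      ennreal \<bar>u (h + x)\<bar> * indicator {x. h \<bullet> a < x \<bullet> a} (h + x) \<partial>lborel)"
    unfolding X_def by (subst nn_integral_add) auto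
  also have "\<dots> \<ge> (\<integral>\<^sup>+ x. ennreal \<bar>u x\<bar> \<partial>lborel)"
  proof (rule nn_integral_mono)
    fix x
    show "ennreal \<bar>u x\<bar> \<le> ennreal \<bar>u x - u (x + h)\<bar> * indicator {x. 0 < x \<bullet> a} x +
      ennreal \<bar>u (h + x)\<bar> * indicator {x. h \<bullet> a < x \<bullet> a} (h + x)"
      using supp[of x]
      by (cases "0 < x \<bullet> a") (auto simp: inner_add_left ennreal_plus[symmetric] ac_simps
          intro!: ennreal_leI simp del: ennreal_plus)
  qed
  finally have "J + M \<le> J + X" unfolding MJ[symmetric] by (simp add: add.commute)
  then have MX: "M \<le> X" using J by (simp add: ennreal_add_left_cancel_le)
  have "M = (\<integral>\<^sup>+ x. ennreal \<bar>u (h + x)\<bar> * indicator {x. x \<bullet> a \<le> h \<bullet> a} (h + x) \<partial>lborel)"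
    unfolding M_def by (rule nn_integral_lborel_add[symmetric]) measurable
  also have "\<dots> = Y"
    unfolding Y_def using supp
    by (intro nn_integral_cong) (auto simp: indicator_def inner_add_left add.commute)
  finally have MY: "M = Y" .
  have "X + Y = shift_diff u h"
    unfolding X_def Y_def shift_diff_def by (subst nn_integral_add[symmetric])
      (auto intro!: nn_integral_cong simp: indicator_def)
  then show ?thesis using add_mono[OF MX eq_refl[OF MY]] by (simp add: M_def mult_2)
qed

text \<open>The pairs with $h \cdot a > 0$ and those with $h \cdot a < 0$ contribute the same by symmetry,
  and each slab estimate has a factor $2$: hence the $4$.\<close>
lemma gagliardo_half_space_lower_bound:
  fixes u :: "'a::euclidean_space \<Rightarrow> real"
  assumes s: "0 < s" and a: "norm a = 1"
    and [measurable]: "u \<in> borel_measurable borel"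
    and fin: "(\<integral>\<^sup>+ x. ennreal \<bar>u x\<bar> \<partial>lborel) < \<infinity>"
    and supp: "\<And>x. x \<bullet> a \<le> 0 \<Longrightarrow> u x = 0"
  shows "ennreal (4 / s * C_const DIM('a) s) * hardy_integral s (half_space a) u \<le> gagliardo s u"
proof -
  let ?k = "singular_kernel s :: 'a \<Rightarrow> ennreal" and ?D = "shift_diff u"
  let ?C = "C_const DIM('a) s"
  have C: "0 < ?C" using s by (intro C_const_pos) (auto simp: Suc_leI)
  define P where "P = (\<integral>\<^sup>+ h. ?k h * ?D h * indicator {h. 0 < h \<bullet> a} h \<partial>lborel)"
  define Q where "Q = (\<integral>\<^sup>+ h. ?k h * ?D h * indicator {h. h \<bullet> a < 0} h \<partial>lborel)"
  have "Q = (\<integral>\<^sup>+ h. ?k (- h) * ?D (- h) * indicator {h. h \<bullet> a < 0} (- h) \<partial>lborel)"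
    unfolding Q_def by (rule nn_integral_lborel_uminus[symmetric]) measurable
  then have QP: "Q = P"
    unfolding P_def by (simp add: singular_kernel_uminus shift_diff_uminus indicator_def)
  have "P + Q = (\<integral>\<^sup>+ h. ?k h * ?D h * indicator {h. 0 < h \<bullet> a} h + ?k h * ?D h * indicator {h. h \<bullet> a < 0} h \<partial>lborel)"
    unfolding P_def Q_def by (rule nn_integral_add[symmetric]) measurable
  also have "\<dots> \<le> gagliardo s u"
    unfolding gagliardo_eq_shift_diff[OF assms(3)] by (intro nn_integral_mono) (auto simp: indicator_def)
  finally have PG: "2 * P \<le> gagliardo s u" by (simp add: QP mult_2)
  have "(\<integral>\<^sup>+ x. ennreal \<bar>u x\<bar> * ennreal (?C / s * (x \<bullet> a) powr (- s)) \<partial>lborel)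
      = (\<integral>\<^sup>+ x. ennreal \<bar>u x\<bar> * (\<integral>\<^sup>+ h. indicator {h. x \<bullet> a \<le> h \<bullet> a} h * ?k h * indicator {h. 0 < h \<bullet> a} h \<partial>lborel) \<partial>lborel)"
  proof (rule nn_integral_cong)
    fix x :: 'a
    show "ennreal \<bar>u x\<bar> * ennreal (?C / s * (x \<bullet> a) powr (- s)) =
      ennreal \<bar>u x\<bar> * (\<integral>\<^sup>+ h. indicator {h. x \<bullet> a \<le> h \<bullet> a} h * ?k h * indicator {h. 0 < h \<bullet> a} h \<partial>lborel)"
    proof (cases "0 < x \<bullet> a")
      case True
      have "(\<integral>\<^sup>+ h. indicator {h. x \<bullet> a \<le> h \<bullet> a} h * ?k h * indicator {h. 0 < h \<bullet> a} h \<partial>lborel)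
        = (\<integral>\<^sup>+ h. indicator {h. x \<bullet> a \<le> h \<bullet> a} h * ?k h \<partial>lborel)"
        using True by (intro nn_integral_cong) (auto simp: indicator_def)
      then show ?thesis by (simp add: kernel_half_space[OF a True s])
    qed (use supp[of x] in simp)
  qed
  also have "\<dots> = (\<integral>\<^sup>+ x. (\<integral>\<^sup>+ h. ennreal \<bar>u x\<bar> * (indicator {h. x \<bullet> a \<le> h \<bullet> a} h * ?k h * indicator {h. 0 < h \<bullet> a} h) \<partial>lborel) \<partial>lborel)"
    by (rule nn_integral_cong, rule nn_integral_cmult[symmetric]) measurable
  also have "\<dots> = (\<integral>\<^sup>+ h. (\<integral>\<^sup>+ x. ennreal \<bar>u x\<bar> * (indicator {h. x \<bullet> a \<le> h \<bullet> a} h * ?k h * indicator {h. 0 < h \<bullet> a} h) \<partial>lborel) \<partial>lborel)"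
    by (rule lborel_pair.Fubini') measurable
  also have "\<dots> = (\<integral>\<^sup>+ h. ?k h * indicator {h. 0 < h \<bullet> a} h * (\<integral>\<^sup>+ x. ennreal \<bar>u x\<bar> * indicator {x. x \<bullet> a \<le> h \<bullet> a} x \<partial>lborel) \<partial>lborel)"
    by (rule nn_integral_cong, subst nn_integral_cmult[symmetric])
      (auto intro!: nn_integral_cong simp: indicator_def mult.commute)
  finally have F: "(\<integral>\<^sup>+ x. ennreal \<bar>u x\<bar> * ennreal (?C / s * (x \<bullet> a) powr (- s)) \<partial>lborel)
      = (\<integral>\<^sup>+ h. ?k h * indicator {h. 0 < h \<bullet> a} h * (\<integral>\<^sup>+ x. ennreal \<bar>u x\<bar> * indicator {x. x \<bullet> a \<le> h \<bullet> a} x \<partial>lborel) \<partial>lborel)" .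
  have "2 * (\<integral>\<^sup>+ x. ennreal \<bar>u x\<bar> * ennreal (?C / s * (x \<bullet> a) powr (- s)) \<partial>lborel)
      = (\<integral>\<^sup>+ h. ?k h * indicator {h. 0 < h \<bullet> a} h * (2 * (\<integral>\<^sup>+ x. ennreal \<bar>u x\<bar> * indicator {x. x \<bullet> a \<le> h \<bullet> a} x \<partial>lborel)) \<partial>lborel)"
    unfolding F by (subst nn_integral_cmult[symmetric]) (auto simp: ac_simps)
  also have "\<dots> \<le> (\<integral>\<^sup>+ h. ?k h * indicator {h. 0 < h \<bullet> a} h * ?D h \<partial>lborel)"
    by (intro nn_integral_mono mult_left_mono half_space_shift_lower_bound assms) auto
  also have "\<dots> = P" unfolding P_def by (simp add: ac_simps)
  finally have "2 * (2 * (\<integral>\<^sup>+ x. ennreal \<bar>u x\<bar> * ennreal (?C / s * (x \<bullet> a) powr (- s)) \<partial>lborel)) \<le> 2 * P"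
    by (rule mult_left_mono) simp
  also note PG
  also have "2 * (2 * (\<integral>\<^sup>+ x. ennreal \<bar>u x\<bar> * ennreal (?C / s * (x \<bullet> a) powr (- s)) \<partial>lborel))
    = ennreal 4 * (\<integral>\<^sup>+ x. ennreal \<bar>u x\<bar> * ennreal (?C / s * (x \<bullet> a) powr (- s)) \<partial>lborel)"
    by (simp add: mult.assoc[symmetric])
  also have "\<dots> = (\<integral>\<^sup>+ x. ennreal 4 * (ennreal \<bar>u x\<bar> * ennreal (?C / s * (x \<bullet> a) powr (- s))) \<partial>lborel)"
    by (rule nn_integral_cmult[symmetric]) measurable
  also have "\<dots> = (\<integral>\<^sup>+ x. ennreal (4 / s * ?C) * (ennreal (\<bar>u x\<bar> / (x \<bullet> a) powr s) * indicator {x. 0 < x \<bullet> a} x) \<partial>lborel)"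
  proof (rule nn_integral_cong)
    fix x
    show "ennreal 4 * (ennreal \<bar>u x\<bar> * ennreal (?C / s * (x \<bullet> a) powr (- s))) =
       ennreal (4 / s * ?C) * (ennreal (\<bar>u x\<bar> / (x \<bullet> a) powr s) * indicator {x. 0 < x \<bullet> a} x)"
    proof (cases "0 < x \<bullet> a")
      case True
      have "4 * (\<bar>u x\<bar> * (?C / s * (x \<bullet> a) powr (- s))) = 4 / s * ?C * (\<bar>u x\<bar> / (x \<bullet> a) powr s)"
        by (simp add: powr_minus_divide)
      then show ?thesis using C s True by (simp add: ennreal_mult[symmetric] del: times_divide_eq_left times_divide_eq_right ennreal_numeral)
    qed (use supp[of x] in simp)
  qed
  also have "\<dots> = ennreal (4 / s * ?C) * hardy_integral s (half_space a) u"
    unfolding hardy_integral_half_space[OF a] by (rule nn_integral_cmult) measurable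
  finally show ?thesis .
qed

text \<open>The pairs inside--outside and outside--inside give the factor $2$; the differences between two
  points of $\Omega$ are discarded, which costs a factor $2$ against the half-space.\<close>
lemma gagliardo_convex_lower_bound:
  fixes u :: "'a::euclidean_space \<Rightarrow> real" and \<Omega> :: "'a set"
  assumes s: "0 < s" and \<Omega>: "open \<Omega>" "convex \<Omega>" "\<Omega> \<noteq> UNIV"
    and [measurable]: "u \<in> borel_measurable borel"
    and supp: "\<And>x. x \<notin> \<Omega> \<Longrightarrow> u x = 0"
  shows "ennreal (2 / s * C_const DIM('a) s) * hardy_integral s \<Omega> u \<le> gagliardo s u"
proof -
  let ?k = "singular_kernel s :: 'a \<Rightarrow> ennreal" and ?C = "C_const DIM('a) s"
  have C: "0 < ?C" using s by (intro C_const_pos) (auto simp: Suc_leI)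
  have [measurable]: "\<Omega> \<in> sets borel" using \<Omega>(1) by simp
  define f where "f x y = ennreal (\<bar>u x - u y\<bar> / norm (x - y) powr (real DIM('a) + s))" for x y
  have [measurable]: "case_prod f \<in> borel_measurable (borel \<Otimes>\<^sub>M borel)"
    unfolding f_def by measurable
  have sym: "f x y = f y x" for x y
    by (simp add: f_def abs_minus_commute norm_minus_commute)
  define P where "P = (\<integral>\<^sup>+ x. (\<integral>\<^sup>+ y. f x y * indicator \<Omega> x * indicator (- \<Omega>) y \<partial>lborel) \<partial>lborel)"
  define Q where "Q = (\<integral>\<^sup>+ x. (\<integral>\<^sup>+ y. f x y * indicator (- \<Omega>) x * indicator \<Omega> y \<partial>lborel) \<partial>lborel)"
  have "Q = (\<integral>\<^sup>+ y. (\<integral>\<^sup>+ x. f x y * indicator (- \<Omega>) x * indicator \<Omega> y \<partial>lborel) \<partial>lborel)"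
    unfolding Q_def by (rule lborel_pair.Fubini'[symmetric]) measurable
  then have QP: "Q = P"
    unfolding P_def by (simp add: sym ac_simps)
  have "P + Q = (\<integral>\<^sup>+ x. (\<integral>\<^sup>+ y. f x y * indicator \<Omega> x * indicator (- \<Omega>) y \<partial>lborel)
      + (\<integral>\<^sup>+ y. f x y * indicator (- \<Omega>) x * indicator \<Omega> y \<partial>lborel) \<partial>lborel)"
    unfolding P_def Q_def by (rule nn_integral_add[symmetric]) measurable
  also have "\<dots> \<le> (\<integral>\<^sup>+ x. (\<integral>\<^sup>+ y. f x y \<partial>lborel) \<partial>lborel)"
    by (rule nn_integral_mono, subst nn_integral_add[symmetric])
      (auto intro!: nn_integral_mono simp: indicator_def)
  also have "\<dots> = gagliardo s u" by (simp add: gagliardo_def f_def)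
  finally have PG: "2 * P \<le> gagliardo s u" by (simp add: QP mult_2)
  have "(\<integral>\<^sup>+ x. ennreal (?C / s) * (ennreal (\<bar>u x\<bar> / boundary_dist \<Omega> x powr s) * indicator \<Omega> x) \<partial>lborel) \<le> P"
    unfolding P_def
  proof (rule nn_integral_mono)
    fix x
    show "ennreal (?C / s) * (ennreal (\<bar>u x\<bar> / boundary_dist \<Omega> x powr s) * indicator \<Omega> x)
      \<le> (\<integral>\<^sup>+ y. f x y * indicator \<Omega> x * indicator (- \<Omega>) y \<partial>lborel)"
    proof (cases "x \<in> \<Omega>")
      case x: True
      obtain p where p: "p \<notin> \<Omega>" "boundary_dist \<Omega> x = dist x p" "0 < boundary_dist \<Omega> x"
        using nearest_boundary_point[OF \<Omega>(1) x \<Omega>(3)] by metis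
      obtain a where a: "norm a = 1" "\<And>y. y \<in> \<Omega> \<Longrightarrow> p \<bullet> a < y \<bullet> a"
        using supporting_half_space[OF \<Omega>(1,2) _ p(1)] x by blast
      let ?d = "boundary_dist \<Omega> x"
      have "(x - p) \<bullet> a \<le> norm (x - p) * norm a" by (rule norm_cauchy_schwarz)
      then have d: "(x - p) \<bullet> a \<le> ?d" using a(1) p(2) by (simp add: dist_norm)
      \<comment> \<open>The complement contains the half-space behind the supporting hyperplane at the nearest boundary point.\<close>
      have out: "x + h \<notin> \<Omega>" if "?d \<le> h \<bullet> (- a)" for h
      proof
        assume "x + h \<in> \<Omega>"
        from a(2)[OF this] have "(p - x) \<bullet> a < h \<bullet> a" by (simp add: inner_diff_left inner_add_left)
        then show False using that d by (simp add: inner_diff_left)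
      qed
      have "ennreal (?C / s) * (ennreal (\<bar>u x\<bar> / ?d powr s) * indicator \<Omega> x)
        = ennreal \<bar>u x\<bar> * ennreal (?C / s * ?d powr (- s))"
        using x C s by (simp add: ennreal_mult[symmetric] powr_minus_divide ac_simps)
      also have "\<dots> = ennreal \<bar>u x\<bar> * (\<integral>\<^sup>+ h. indicator {h. ?d \<le> h \<bullet> (- a)} h * ?k h \<partial>lborel)"
        by (subst kernel_half_space) (use a p s in auto)
      also have "\<dots> = (\<integral>\<^sup>+ h. ennreal \<bar>u x\<bar> * (indicator {h. ?d \<le> h \<bullet> (- a)} h * ?k h) \<partial>lborel)"
        by (rule nn_integral_cmult[symmetric]) measurable
      also have "\<dots> \<le> (\<integral>\<^sup>+ h. f x (x + h) * indicator \<Omega> x * indicator (- \<Omega>) (x + h) \<partial>lborel)"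
      proof (rule nn_integral_mono)
        fix h
        show "ennreal \<bar>u x\<bar> * (indicator {h. ?d \<le> h \<bullet> (- a)} h * ?k h)
          \<le> f x (x + h) * indicator \<Omega> x * indicator (- \<Omega>) (x + h)"
          using x out[of h] supp[of "x + h"]
          by (cases "?d \<le> h \<bullet> (- a)")
            (auto simp: f_def singular_kernel_def ennreal_mult[symmetric])
      qed
      also have "\<dots> = (\<integral>\<^sup>+ y. f x y * indicator \<Omega> x * indicator (- \<Omega>) y \<partial>lborel)"
        by (rule nn_integral_lborel_add) measurable
      finally show ?thesis .
    qed simp
  qed
  then have "2 * (\<integral>\<^sup>+ x. ennreal (?C / s) * (ennreal (\<bar>u x\<bar> / boundary_dist \<Omega> x powr s) * indicator \<Omega> x) \<partial>lborel) \<le> 2 * P"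
    by (rule mult_left_mono) simp
  also note PG
  also have "(\<integral>\<^sup>+ x. ennreal (?C / s) * (ennreal (\<bar>u x\<bar> / boundary_dist \<Omega> x powr s) * indicator \<Omega> x) \<partial>lborel)
      = ennreal (?C / s) * hardy_integral s \<Omega> u"
    unfolding hardy_integral_def
    by (rule nn_integral_cmult) measurable
  also have "2 * (ennreal (?C / s) * hardy_integral s \<Omega> u) = (ennreal 2 * ennreal (?C / s)) * hardy_integral s \<Omega> u"
    by (simp add: mult.assoc)
  also have "ennreal 2 * ennreal (?C / s) = ennreal (2 / s * ?C)"
    using C s by (subst ennreal_mult[symmetric]) auto
  finally show ?thesis .
qed

section \<open>Test functions on boxes\<close>

text \<open>A monotone transition from $0$ to $1$ has translation difference $|h|$, whatever its profile, even
  if it jumps.  For $h \ge 0$ the integral of $S(x+h) - S(x)$ telescopes: cut off at $M$, where the step has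
  reached $1$, both terms have finite integrals, and these differ by the integral of $S = 1$ over an
  interval of length $h$.\<close>

lemma shift_diff_step:
  fixes S :: "real \<Rightarrow> real"
  assumes S: "mono S" and S0: "\<And>x. x \<le> m \<Longrightarrow> S x = 0" and S1: "\<And>x. M \<le> x \<Longrightarrow> S x = 1"
  shows "shift_diff S h = ennreal \<bar>h\<bar>"
proof -
  have [measurable]: "S \<in> borel_measurable borel" by (rule borel_measurable_mono[OF S])
  have mM: "m < M" using S0[of M] S1[of M] by force
  have rng: "0 \<le> S x" "S x \<le> 1" for x
    using monoD[OF S, of "min x m" x] S0[of "min x m"] monoD[OF S, of x "max x M"] S1[of "max x M"] by auto
  have pos: "shift_diff S h = ennreal h" if h: "0 \<le> h" for h
  proof -
    define P where "P = (\<integral>\<^sup>+ x. ennreal (S x) * indicator {..M} x \<partial>lborel)"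
    have "P \<le> (\<integral>\<^sup>+ x. indicator {m..M} x \<partial>lborel)"
      unfolding P_def
    proof (rule nn_integral_mono)
      fix x
      show "ennreal (S x) * indicator {..M} x \<le> indicator {m..M} x"
        using S0[of x] rng[of x] by (cases "m \<le> x") (auto simp: indicator_def ennreal_le_1)
    qed
    also have "\<dots> < \<infinity>" using mM by simp
    finally have fin: "P \<noteq> \<infinity>" by simp
    have "(\<integral>\<^sup>+ x. ennreal (S (h + x)) * indicator {..M + h} (h + x) \<partial>lborel)
        = (\<integral>\<^sup>+ x. ennreal (S x) * indicator {..M + h} x \<partial>lborel)"
      by (rule nn_integral_lborel_add) measurable
    also have "\<dots> = (\<integral>\<^sup>+ x. ennreal (S x) * indicator {..M} x + indicator {M<..M + h} x \<partial>lborel)"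
      using h S1 by (intro nn_integral_cong) (auto simp: indicator_def)
    also have "\<dots> = P + ennreal h"
      using h by (subst nn_integral_add) (auto simp: P_def)
    finally have a: "(\<integral>\<^sup>+ x. ennreal (S (h + x)) * indicator {..M + h} (h + x) \<partial>lborel) = P + ennreal h" .
    have "(\<integral>\<^sup>+ x. ennreal (S (h + x)) * indicator {..M + h} (h + x) \<partial>lborel)
        = (\<integral>\<^sup>+ x. ennreal (S x) * indicator {..M} x + ennreal \<bar>S x - S (x + h)\<bar> \<partial>lborel)"
    proof (rule nn_integral_cong)
      fix x
      have "S x \<le> S (x + h)" by (rule monoD[OF S]) (use h in simp)
      then show "ennreal (S (h + x)) * indicator {..M + h} (h + x)
          = ennreal (S x) * indicator {..M} x + ennreal \<bar>S x - S (x + h)\<bar>"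
        using h S1[of x] S1[of "x + h"] rng[of x]
        by (cases "x \<le> M") (auto simp: add.commute ennreal_plus[symmetric] simp del: ennreal_plus)
    qed
    also have "\<dots> = P + shift_diff S h"
      unfolding P_def shift_diff_def by (rule nn_integral_add) measurable
    finally have "P + shift_diff S h = P + ennreal h" unfolding a by (rule sym)
    then show ?thesis using fin by (auto simp: ennreal_add_left_cancel)
  qed
  show ?thesis
  proof (cases "0 \<le> h")
    case False
    then show ?thesis using pos[of "- h"] shift_diff_uminus[of S h] by simp
  qed (simp add: pos)
qed

lemma nn_integral_powr_from_0:
  assumes "0 < s" "s < 1" "0 \<le> l" "0 \<le> c"
  shows "(\<integral>\<^sup>+ t. indicator {0..l} t * ennreal (c * t powr (- s)) \<partial>lborel) = ennreal (c * (l powr (1 - s) / (1 - s)))"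
proof -
  have "((\<lambda>t. t powr (- s)) has_integral (l powr (- s + 1) / (- s + 1))) {0..l}"
    using assms by (intro has_integral_powr_from_0) auto
  then have "((\<lambda>t. c * t powr (- s)) has_integral (c * (l powr (- s + 1) / (- s + 1)))) {0..l}"
    by (rule has_integral_mult_right)
  from nn_integral_has_integral_lebesgue[OF _ this] assms
  show ?thesis by (simp add: ennreal_mult' ennreal_indicator)
qed

text \<open>Layer-cake formula: $\min(|h \cdot a|, l)$ is the measure of the $t \in [0,l]$ with
  $t \le |h \cdot a|$, and for each $t$ the kernel has mass $2 t^{-s} C_{N,s}/s$ on the corresponding
  pair of half-spaces.\<close>
lemma kernel_min_integral:
  fixes a :: "'a::euclidean_space"
  assumes s: "0 < s" "s < 1" and a: "norm a = 1" and l: "0 \<le> l"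
  shows "(\<integral>\<^sup>+ h. singular_kernel s h * ennreal (min \<bar>h \<bullet> a\<bar> l) \<partial>lborel)
    = ennreal (2 / s * C_const DIM('a) s * (l powr (1 - s) / (1 - s)))"
proof -
  let ?k = "singular_kernel s :: 'a \<Rightarrow> ennreal" and ?C = "C_const DIM('a) s"
  have C: "0 < ?C" using s by (intro C_const_pos) (auto simp: Suc_leI)
  have tail: "(\<integral>\<^sup>+ h. ?k h * indicator {h. t \<le> \<bar>h \<bullet> a\<bar>} h \<partial>lborel) = ennreal (2 / s * ?C * t powr (- s))"
    if t: "0 < t" for t
  proof -
    have "(\<integral>\<^sup>+ h. ?k h * indicator {h. t \<le> \<bar>h \<bullet> a\<bar>} h \<partial>lborel)
      = (\<integral>\<^sup>+ h. indicator {h. t \<le> h \<bullet> a} h * ?k h + indicator {h. t \<le> h \<bullet> (- a)} h * ?k h \<partial>lborel)"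
      using t by (intro nn_integral_cong) (auto simp: indicator_def)
    also have "\<dots> = ennreal (?C / s * t powr (- s)) + ennreal (?C / s * t powr (- s))"
      by (subst nn_integral_add) (use a t s in \<open>auto simp: kernel_half_space simp del: inner_minus_right\<close>)
    also have "\<dots> = ennreal (2 / s * ?C * t powr (- s))"
      using C s by (subst ennreal_plus[symmetric]) auto
    finally show ?thesis .
  qed
  have "(\<integral>\<^sup>+ h. ?k h * ennreal (min \<bar>h \<bullet> a\<bar> l) \<partial>lborel)
    = (\<integral>\<^sup>+ h. (\<integral>\<^sup>+ t. ?k h * (indicator {0..l} t * indicator {h. t \<le> \<bar>h \<bullet> a\<bar>} h) \<partial>lborel) \<partial>lborel)"
  proof (rule nn_integral_cong)
    fix h :: 'a
    have "ennreal (min \<bar>h \<bullet> a\<bar> l) = emeasure lborel {0..min \<bar>h \<bullet> a\<bar> l}" using l by simp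
    also have "\<dots> = (\<integral>\<^sup>+ t. indicator {0..min \<bar>h \<bullet> a\<bar> l} t \<partial>lborel)" by simp
    also have "\<dots> = (\<integral>\<^sup>+ t. indicator {0..l} t * indicator {h. t \<le> \<bar>h \<bullet> a\<bar>} h \<partial>lborel)"
      by (intro nn_integral_cong) (auto simp: indicator_def)
    finally show "?k h * ennreal (min \<bar>h \<bullet> a\<bar> l)
      = (\<integral>\<^sup>+ t. ?k h * (indicator {0..l} t * indicator {h. t \<le> \<bar>h \<bullet> a\<bar>} h) \<partial>lborel)"
      by (simp add: nn_integral_cmult)
  qed
  also have "\<dots> = (\<integral>\<^sup>+ t. (\<integral>\<^sup>+ h. ?k h * (indicator {0..l} t * indicator {h. t \<le> \<bar>h \<bullet> a\<bar>} h) \<partial>lborel) \<partial>lborel)"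
    by (rule lborel_pair.Fubini') measurable
  also have "\<dots> = (\<integral>\<^sup>+ t. (\<integral>\<^sup>+ h. indicator {0..l} t * (?k h * indicator {h. t \<le> \<bar>h \<bullet> a\<bar>} h) \<partial>lborel) \<partial>lborel)"
    by (simp add: mult.left_commute)
  also have "\<dots> = (\<integral>\<^sup>+ t. indicator {0..l} t * (\<integral>\<^sup>+ h. ?k h * indicator {h. t \<le> \<bar>h \<bullet> a\<bar>} h \<partial>lborel) \<partial>lborel)"
    by (rule nn_integral_cong, rule nn_integral_cmult) measurable
  also have "\<dots> = (\<integral>\<^sup>+ t. indicator {0..l} t * ennreal (2 / s * ?C * t powr (- s)) \<partial>lborel)"
  proof (rule nn_integral_cong_AE, use AE_lborel_singleton[of "0::real"] in eventually_elim)
    case (elim t)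
    then show ?case
    proof (cases "0 < t")
      case False
      with elim have "t \<notin> {0..l}" by simp
      then show ?thesis by simp
    qed (simp only: tail)
  qed
  also have "\<dots> = ennreal (2 / s * ?C * (l powr (1 - s) / (1 - s)))"
    using C s l by (intro nn_integral_powr_from_0) auto
  finally show ?thesis .
qed

text \<open>A smooth replacement for the indicator of an interval of length $l$.  The shift by $1$
  keeps the support at distance at least $1$ from the boundary point $0$; writing the function as a difference of
  two steps makes its integral equal to $l$ exactly.\<close>
definition plateau :: "(real \<Rightarrow> real) \<Rightarrow> real \<Rightarrow> real \<Rightarrow> real" where
  "plateau F l x = F (x - 1) - F (x - 1 - l)"

context smooth_step
begin

lemma F_measurable: "F \<in> borel_measurable borel"
  by (rule borel_measurable_mono[OF mono_F])

lemma plateau_measurable: "plateau F l \<in> borel_measurable borel"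
proof -
  note F_measurable [measurable]
  show ?thesis unfolding plateau_def[abs_def] by measurable
qed

lemma plateau_smooth: "times_cont_differentiable k (plateau F l)"
proof -
  have "times_cont_differentiable k (\<lambda>x. F (x + c))" for c
    by (rule times_cont_differentiable_affine[OF bounded_linear_ident smooth])
  from times_cont_differentiable_diff[OF this[of "- 1"] this[of "- 1 - l"]]
  show ?thesis by (simp add: plateau_def[abs_def] algebra_simps)
qed

lemma plateau_nonneg: "0 \<le> l \<Longrightarrow> 0 \<le> plateau F l x"
  using monoD[OF mono_F, of "x - 1 - l" "x - 1"] by (simp add: plateau_def)

lemma plateau_support: "0 \<le> l \<Longrightarrow> plateau F l x \<noteq> 0 \<Longrightarrow> 1 \<le> x \<and> x \<le> l + 2"
  using eq_0[of "x - 1"] eq_0[of "x - 1 - l"] eq_1[of "x - 1"] eq_1[of "x - 1 - l"]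
  by (auto simp: plateau_def not_le) (smt (verit))+

lemma plateau_eq_1: "2 \<le> x \<Longrightarrow> x \<le> l + 1 \<Longrightarrow> plateau F l x = 1"
  using eq_1[of "x - 1"] eq_0[of "x - 1 - l"] by (simp add: plateau_def)

lemma shift_diff_F: "shift_diff F h = ennreal \<bar>h\<bar>"
  by (rule shift_diff_step[OF mono_F eq_0 eq_1])

lemma plateau_integral:
  assumes "0 \<le> l"
  shows "(\<integral>\<^sup>+ x. ennreal (plateau F l x) \<partial>lborel) = ennreal l"
proof -
  have "(\<integral>\<^sup>+ x. ennreal (plateau F l x) \<partial>lborel) = (\<integral>\<^sup>+ x. ennreal \<bar>F (- 1 + x) - F (- 1 + x + (- l))\<bar> \<partial>lborel)"
    using plateau_nonneg[OF assms]
    by (intro nn_integral_cong) (simp add: plateau_def algebra_simps)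
  also have "\<dots> = shift_diff F (- l)" by (rule shift_diff_shifted[OF F_measurable])
  finally show ?thesis using assms by (simp add: shift_diff_F)
qed

lemma plateau_shift_diff:
  assumes "0 \<le> l"
  shows "shift_diff (plateau F l) h \<le> ennreal (2 * min \<bar>h\<bar> l)"
proof -
  note F_measurable [measurable]
  have sh: "shift_diff (\<lambda>x. F (x + c)) h = ennreal \<bar>h\<bar>" for c
    using shift_diff_shifted[OF F_measurable, of c h]
    by (simp add: shift_diff_def[of "\<lambda>x. F (x + c)"] shift_diff_F ac_simps)
  have "shift_diff (plateau F l) h \<le> shift_diff (\<lambda>x. F (x + (- 1))) h + shift_diff (\<lambda>x. F (x + (- 1 - l))) h"
    using shift_diff_diff[of "\<lambda>x. F (x + (- 1))" "\<lambda>x. F (x + (- 1 - l))" h]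
    by (simp add: plateau_def[abs_def] algebra_simps)
  then have "shift_diff (plateau F l) h \<le> ennreal (2 * \<bar>h\<bar>)"
    unfolding sh by (simp add: ennreal_plus[symmetric] del: ennreal_plus)
  moreover have "shift_diff (plateau F l) h \<le> ennreal (2 * l)"
    using shift_diff_le_norm[OF plateau_measurable, of l h] assms
    by (simp add: plateau_nonneg plateau_integral ennreal_mult)
  ultimately show ?thesis by (simp add: min_def)
qed

end

text \<open>Translating a product along one axis changes a single factor.\<close>
lemma shift_diff_product:
  fixes e :: "'a::euclidean_space"
  assumes e: "e \<in> Basis" and \<phi>: "\<And>i. i \<in> Basis \<Longrightarrow> \<phi> i \<in> borel_measurable borel" "\<And>i x. i \<in> Basis \<Longrightarrow> 0 \<le> \<phi> i x"
  shows "shift_diff (\<lambda>x. \<Prod>i\<in>Basis. \<phi> i (x \<bullet> i)) (t *\<^sub>R e)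
    = shift_diff (\<phi> e) t * (\<Prod>i\<in>Basis - {e}. (\<integral>\<^sup>+ x. ennreal (\<phi> i x) \<partial>lborel))"
proof -
  define g where "g i y = (if i = e then ennreal \<bar>\<phi> e y - \<phi> e (y + t)\<bar> else ennreal (\<phi> i y))" for i y
  have [measurable]: "\<phi> e \<in> borel_measurable borel" using \<phi>(1)[OF e] .
  have gm: "g i \<in> borel_measurable borel" if "i \<in> Basis" for i
    using \<phi>(1)[OF that] unfolding g_def[abs_def] by (cases "i = e") auto
  have "shift_diff (\<lambda>x. \<Prod>i\<in>Basis. \<phi> i (x \<bullet> i)) (t *\<^sub>R e) = (\<integral>\<^sup>+ x. (\<Prod>i\<in>Basis. g i (x \<bullet> i)) \<partial>lborel)"
    unfolding shift_diff_def
  proof (rule nn_integral_cong)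
    fix x :: 'a
    have *: "(\<Prod>i\<in>Basis. \<phi> i (z \<bullet> i)) = \<phi> e (z \<bullet> e) * (\<Prod>i\<in>Basis - {e}. \<phi> i (z \<bullet> i))" for z :: 'a
      by (rule prod.remove[OF _ e]) simp
    have "(\<Prod>i\<in>Basis - {e}. \<phi> i ((x + t *\<^sub>R e) \<bullet> i)) = (\<Prod>i\<in>Basis - {e}. \<phi> i (x \<bullet> i))"
      using e by (intro prod.cong) (auto simp: inner_add_left inner_not_same_Basis)
    then have "\<bar>(\<Prod>i\<in>Basis. \<phi> i (x \<bullet> i)) - (\<Prod>i\<in>Basis. \<phi> i ((x + t *\<^sub>R e) \<bullet> i))\<bar>
      = \<bar>\<phi> e (x \<bullet> e) - \<phi> e (x \<bullet> e + t)\<bar> * (\<Prod>i\<in>Basis - {e}. \<phi> i (x \<bullet> i))"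
      using e \<phi>(2) unfolding *
      by (simp add: inner_add_left left_diff_distrib[symmetric] abs_mult abs_prod prod_nonneg)
    moreover have "(\<Prod>i\<in>Basis. g i (x \<bullet> i)) = ennreal \<bar>\<phi> e (x \<bullet> e) - \<phi> e (x \<bullet> e + t)\<bar> * (\<Prod>i\<in>Basis - {e}. ennreal (\<phi> i (x \<bullet> i)))"
      by (subst prod.remove[OF _ e]) (auto simp: g_def intro!: arg_cong2[where f="(*)"] prod.cong)
    moreover have "(\<Prod>i\<in>Basis - {e}. ennreal (\<phi> i (x \<bullet> i))) = ennreal (\<Prod>i\<in>Basis - {e}. \<phi> i (x \<bullet> i))"
      using \<phi>(2) by (intro prod_ennreal) auto
    moreover have "0 \<le> (\<Prod>i\<in>Basis - {e}. \<phi> i (x \<bullet> i))"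
      using \<phi>(2) by (intro prod_nonneg) auto
    ultimately show "ennreal \<bar>(\<Prod>i\<in>Basis. \<phi> i (x \<bullet> i)) - (\<Prod>i\<in>Basis. \<phi> i ((x + t *\<^sub>R e) \<bullet> i))\<bar>
      = (\<Prod>i\<in>Basis. g i (x \<bullet> i))"
      by (simp add: ennreal_mult)
  qed
  also have "\<dots> = (\<Prod>i\<in>Basis. (\<integral>\<^sup>+ x. g i x \<partial>lborel))"
    by (rule nn_integral_lborel_prod) (use gm in auto)
  also have "\<dots> = (\<integral>\<^sup>+ x. g e x \<partial>lborel) * (\<Prod>i\<in>Basis - {e}. (\<integral>\<^sup>+ x. g i x \<partial>lborel))"
    by (rule prod.remove[OF _ e]) simp
  also have "(\<integral>\<^sup>+ x. g e x \<partial>lborel) = shift_diff (\<phi> e) t"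
    by (simp add: g_def shift_diff_def)
  also have "(\<Prod>i\<in>Basis - {e}. (\<integral>\<^sup>+ x. g i x \<partial>lborel)) = (\<Prod>i\<in>Basis - {e}. (\<integral>\<^sup>+ x. ennreal (\<phi> i x) \<partial>lborel))"
    by (intro prod.cong) (auto simp: g_def)
  finally show ?thesis .
qed

lemma smooth_compact_supportD:
  assumes "u \<in> smooth_compact_support \<Omega>"
  shows "times_cont_differentiable k u" "continuous_on UNIV u" "u \<in> borel_measurable borel"
    "\<And>x. x \<notin> \<Omega> \<Longrightarrow> u x = 0" "compact (closure {x. u x \<noteq> 0})"
proof -
  have all: "\<forall>k. times_cont_differentiable k u" "closure {x. u x \<noteq> 0} \<subseteq> \<Omega>" "compact (closure {x. u x \<noteq> 0})"
    using assms by (auto simp: smooth_compact_support_def)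
  then show "times_cont_differentiable k u" "compact (closure {x. u x \<noteq> 0})" by auto
  have "times_cont_differentiable 0 u" using all by blast
  then show c: "continuous_on UNIV u" by simp
  then show "u \<in> borel_measurable borel" by (rule borel_measurable_continuous_onI)
  show "u x = 0" if "x \<notin> \<Omega>" for x
    using all(2) closure_subset[of "{x. u x \<noteq> 0}"] that by blast
qed

lemma smooth_compact_support_integrable:
  assumes "u \<in> smooth_compact_support \<Omega>"
  shows "(\<integral>\<^sup>+ x. ennreal \<bar>u x\<bar> \<partial>lborel) < \<infinity>"
proof -
  let ?K = "closure {x. u x \<noteq> 0}"
  note u = smooth_compact_supportD[OF assms]
  have "compact (u ` ?K)"
    by (rule compact_continuous_image[OF continuous_on_subset[OF u(2)] u(5)]) simp
  then obtain B where B: "\<And>x. x \<in> ?K \<Longrightarrow> norm (u x) \<le> B"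
    using compact_imp_bounded bounded_iff by (metis imageI)
  have "(\<integral>\<^sup>+ x. ennreal \<bar>u x\<bar> \<partial>lborel) \<le> (\<integral>\<^sup>+ x. ennreal (max B 0) * indicator ?K x \<partial>lborel)"
  proof (rule nn_integral_mono)
    fix x
    show "ennreal \<bar>u x\<bar> \<le> ennreal (max B 0) * indicator ?K x"
    proof (cases "u x = 0")
      case False
      then have "x \<in> ?K" using closure_subset[of "{x. u x \<noteq> 0}"] by blast
      then show ?thesis using B[of x] by (auto intro!: ennreal_leI)
    qed simp
  qed
  also have "\<dots> = ennreal (max B 0) * emeasure lborel ?K"
    by (rule nn_integral_cmult_indicator) simp
  also have "\<dots> < \<infinity>"
    using emeasure_compact_finite[OF u(5)] by (simp add: ennreal_mult_less_top)
  finally show ?thesis .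
qed

text \<open>Normalizing $v$ produces a competitor in the infimum.\<close>
lemma hardy_const_mult_le:
  assumes v: "v \<in> smooth_compact_support \<Omega>" and pos: "0 < hardy_integral s \<Omega> v"
    and fin: "hardy_integral s \<Omega> v < \<infinity>"
  shows "hardy_const s \<Omega> * hardy_integral s \<Omega> v \<le> gagliardo s v"
proof -
  note vD = smooth_compact_supportD[OF v]
  have [measurable]: "v \<in> borel_measurable borel" by (rule vD)
  define A where "A = enn2real (hardy_integral s \<Omega> v)"
  have A: "hardy_integral s \<Omega> v = ennreal A" using fin by (simp add: A_def)
  have A0: "0 < A" using pos A by (metis ennreal_less_zero_iff)
  define w where "w x = (1 / A) * v x" for x
  have nz: "{x. w x \<noteq> 0} = {x. v x \<noteq> 0}" using A0 by (auto simp: w_def)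
  have "times_cont_differentiable k w" for k
    unfolding w_def[abs_def] by (intro times_cont_differentiable_mult times_cont_differentiable_const vD)
  then have w: "w \<in> smooth_compact_support \<Omega>"
    using v by (simp add: smooth_compact_support_def nz)
  have "hardy_integral s \<Omega> w = (\<integral>\<^sup>+ x. ennreal (1 / A) * (ennreal (\<bar>v x\<bar> / boundary_dist \<Omega> x powr s) * indicator \<Omega> x) \<partial>lborel)"
    unfolding hardy_integral_def
  proof (rule nn_integral_cong)
    fix x
    have "ennreal (\<bar>w x\<bar> / boundary_dist \<Omega> x powr s) = ennreal (1 / A) * ennreal (\<bar>v x\<bar> / boundary_dist \<Omega> x powr s)"
      using A0 by (subst ennreal_mult[symmetric]) (auto simp: w_def abs_mult)
    then show "ennreal (\<bar>w x\<bar> / boundary_dist \<Omega> x powr s) * indicator \<Omega> x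
      = ennreal (1 / A) * (ennreal (\<bar>v x\<bar> / boundary_dist \<Omega> x powr s) * indicator \<Omega> x)"
      by (simp add: mult.assoc)
  qed
  also have "\<dots> = ennreal (1 / A) * hardy_integral s \<Omega> v"
    unfolding hardy_integral_def
  proof (rule nn_integral_cmult)
    show "(\<lambda>x. ennreal (\<bar>v x\<bar> / boundary_dist \<Omega> x powr s) * indicator \<Omega> x) \<in> borel_measurable lborel"
    proof -
      have "(\<lambda>x. ennreal (\<bar>v x\<bar> / boundary_dist \<Omega> x powr s) * indicator \<Omega> x)
        = (\<lambda>x. ennreal (\<bar>v x\<bar> / boundary_dist \<Omega> x powr s))"
        using vD(4) by (auto simp: indicator_def fun_eq_iff)
      then show ?thesis by simp
    qed
  qed
  also have "\<dots> = 1" using A0 by (simp add: A ennreal_mult[symmetric])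
  finally have "hardy_const s \<Omega> \<le> gagliardo s w"
    unfolding hardy_const_def using w by (intro INF_lower) auto
  also have "\<dots> = ennreal (1 / A) * gagliardo s v"
    unfolding w_def[abs_def] using A0 by (subst gagliardo_cmult) auto
  finally have "hardy_const s \<Omega> * ennreal A \<le> ennreal (1 / A) * gagliardo s v * ennreal A"
    by (rule mult_right_mono) simp
  also have "\<dots> = (ennreal (1 / A) * ennreal A) * gagliardo s v" by (simp add: ac_simps)
  also have "ennreal (1 / A) * ennreal A = 1" using A0 by (simp add: ennreal_mult[symmetric])
  finally show ?thesis by (simp add: A)
qed

text \<open>For the product of plateaus, subadditivity of the translation difference bounds it by the sum of its
  values along the axes, each at most $2 \min(|h_i|, l_i) \prod_{j \ne i} l_j$; the
  kernel integral of this minimum is known.  The weighted integral factorizes, and the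
  factor along $e$ is bounded from below by the part of the plateau that equals $1$, the interval
  $[2, l_e + 1]$.\<close>
lemma box_test_function:
  fixes e :: "'a::euclidean_space" and l :: "'a \<Rightarrow> real"
  assumes s: "0 < s" "s < 1" and e: "e \<in> Basis" and l: "\<And>i. 0 < l i"
  obtains u where "u \<in> smooth_compact_support (half_space e)"
    "gagliardo s u \<le> ennreal (4 / s * C_const DIM('a) s / (1 - s) * (\<Prod>i\<in>Basis. l i) * (\<Sum>i\<in>Basis. l i powr (- s)))"
    "ennreal (((l e + 1) powr (1 - s) - 2 powr (1 - s)) / (1 - s) * (\<Prod>i\<in>Basis - {e}. l i)) \<le> hardy_integral s (half_space e) u"
proof -
  let ?C = "C_const DIM('a) s" and ?k = "singular_kernel s :: 'a \<Rightarrow> ennreal"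
  have C: "0 < ?C" using s by (intro C_const_pos) (auto simp: Suc_leI)
  obtain F where "smooth_step F" by (rule smooth_step_exists)
  then interpret smooth_step F .
  have l0: "0 \<le> l i" for i using l[of i] by simp
  define \<phi> where "\<phi> i = plateau F (l i)" for i
  have \<phi>m: "\<phi> i \<in> borel_measurable borel" for i unfolding \<phi>_def by (rule plateau_measurable)
  note \<phi>m [measurable]
  have \<phi>0: "0 \<le> \<phi> i x" for i x unfolding \<phi>_def by (rule plateau_nonneg[OF l0])
  have \<phi>I: "(\<integral>\<^sup>+ x. ennreal (\<phi> i x) \<partial>lborel) = ennreal (l i)" for i unfolding \<phi>_def by (rule plateau_integral[OF l0])
  define u where "u x = (\<Prod>i\<in>Basis. \<phi> i (x \<bullet> i))" for x :: 'a
  have um [measurable]: "u \<in> borel_measurable borel" unfolding u_def[abs_def] by measurable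
  have prodI: "(\<Prod>i\<in>I. ennreal (l i)) = ennreal (\<Prod>i\<in>I. l i)" for I by (rule prod_ennreal) (rule l0)
  show ?thesis
  proof (rule that[of u])
    show "u \<in> smooth_compact_support (half_space e)"
    proof -
      have all_orders: "times_cont_differentiable k u" for k
      proof -
        have "times_cont_differentiable k (\<lambda>x::'a. \<phi> i (x \<bullet> i + 0))" for i
          unfolding \<phi>_def by (rule times_cont_differentiable_affine[OF bounded_linear_inner_left plateau_smooth])
        then show ?thesis unfolding u_def[abs_def] by (intro times_cont_differentiable_prod) simp
      qed
      let ?B = "cbox (\<Sum>i\<in>Basis. i) (\<Sum>i\<in>Basis. (l i + 2) *\<^sub>R i) :: 'a set"
      have inB: "x \<in> ?B \<longleftrightarrow> (\<forall>i\<in>Basis. 1 \<le> x \<bullet> i \<and> x \<bullet> i \<le> l i + 2)" for x :: 'a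
        using inner_sum_left_Basis[where f="\<lambda>_. 1::real"] by (simp add: mem_box)
      have "{x. u x \<noteq> 0} \<subseteq> ?B"
      proof
        fix x assume "x \<in> {x. u x \<noteq> 0}"
        then have "\<forall>i\<in>Basis. \<phi> i (x \<bullet> i) \<noteq> 0" by (simp add: u_def)
        then show "x \<in> ?B" using plateau_support[OF l0] unfolding inB \<phi>_def by blast
      qed
      then have cl: "closure {x. u x \<noteq> 0} \<subseteq> ?B" by (rule closure_minimal) (rule closed_cbox)
      have "compact (closure {x. u x \<noteq> 0})"
        unfolding compact_closure using bounded_cbox \<open>{x. u x \<noteq> 0} \<subseteq> ?B\<close> by (rule bounded_subset)
      moreover have "?B \<subseteq> half_space e"
        using e by (auto simp: inB half_space_def) (smt (verit))
      ultimately show ?thesis using all_orders cl by (auto simp: smooth_compact_support_def)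
    qed
    have dir: "shift_diff u (t *\<^sub>R i) \<le> ennreal (2 * min \<bar>t\<bar> (l i)) * ennreal (\<Prod>j\<in>Basis - {i}. l j)" if "i \<in> Basis" for i t
      unfolding u_def[abs_def] shift_diff_product[OF that \<phi>m \<phi>0] \<phi>I prodI
      by (intro mult_right_mono) (auto simp: \<phi>_def intro: plateau_shift_diff[OF l0])
    have "gagliardo s u = (\<integral>\<^sup>+ h. ?k h * shift_diff u h \<partial>lborel)" by (rule gagliardo_eq_shift_diff[OF um])
    also have "\<dots> \<le> (\<integral>\<^sup>+ h. (\<Sum>i\<in>Basis. ennreal (2 * (\<Prod>j\<in>Basis - {i}. l j)) * (?k h * ennreal (min \<bar>h \<bullet> i\<bar> (l i)))) \<partial>lborel)"
    proof (rule nn_integral_mono)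
      fix h :: 'a
      have "shift_diff u h \<le> (\<Sum>i\<in>Basis. shift_diff u ((h \<bullet> i) *\<^sub>R i))"
        using shift_diff_sum[OF um finite_Basis, of "\<lambda>i. (h \<bullet> i) *\<^sub>R i"] by (simp add: euclidean_representation)
      also have "\<dots> \<le> (\<Sum>i\<in>Basis. ennreal (2 * min \<bar>h \<bullet> i\<bar> (l i)) * ennreal (\<Prod>j\<in>Basis - {i}. l j))"
        by (rule sum_mono) (rule dir)
      also have "\<dots> = (\<Sum>i\<in>Basis. ennreal (2 * (\<Prod>j\<in>Basis - {i}. l j)) * ennreal (min \<bar>h \<bullet> i\<bar> (l i)))"
        using l0 by (intro sum.cong) (auto simp: ennreal_mult[symmetric] prod_nonneg ac_simps min_def)
      finally have "?k h * shift_diff u h \<le> ?k h * \<dots>" by (rule mult_left_mono) simp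
      then show "?k h * shift_diff u h \<le> (\<Sum>i\<in>Basis. ennreal (2 * (\<Prod>j\<in>Basis - {i}. l j)) * (?k h * ennreal (min \<bar>h \<bullet> i\<bar> (l i))))"
        by (simp add: sum_distrib_left ac_simps)
    qed
    also have "\<dots> = (\<Sum>i\<in>Basis. (\<integral>\<^sup>+ h. ennreal (2 * (\<Prod>j\<in>Basis - {i}. l j)) * (?k h * ennreal (min \<bar>h \<bullet> i\<bar> (l i))) \<partial>lborel))"
      by (rule nn_integral_sum) measurable
    also have "\<dots> = (\<Sum>i\<in>Basis. ennreal (2 * (\<Prod>j\<in>Basis - {i}. l j)) * ennreal (2 / s * ?C * (l i powr (1 - s) / (1 - s))))"
      by (intro sum.cong refl, subst nn_integral_cmult) (auto simp: kernel_min_integral[OF s _ l0])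
    also have "\<dots> = (\<Sum>i\<in>Basis. ennreal (4 / s * ?C / (1 - s) * (\<Prod>i\<in>Basis. l i) * l i powr (- s)))"
    proof (rule sum.cong[OF refl])
      fix i :: 'a assume i: "i \<in> Basis"
      have "(\<Prod>i\<in>Basis. l i) = l i * (\<Prod>j\<in>Basis - {i}. l j)" by (rule prod.remove[OF _ i]) simp
      moreover have "l i powr (1 - s) = l i * l i powr (- s)" using l[of i] by (simp add: powr_diff powr_minus divide_inverse)
      ultimately have "2 * (\<Prod>j\<in>Basis - {i}. l j) * (2 / s * ?C * (l i powr (1 - s) / (1 - s)))
        = 4 / s * ?C / (1 - s) * (\<Prod>i\<in>Basis. l i) * l i powr (- s)" by simp
      then show "ennreal (2 * (\<Prod>j\<in>Basis - {i}. l j)) * ennreal (2 / s * ?C * (l i powr (1 - s) / (1 - s)))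
        = ennreal (4 / s * ?C / (1 - s) * (\<Prod>i\<in>Basis. l i) * l i powr (- s))"
        using C s l0 by (subst ennreal_mult[symmetric]) (auto simp: prod_nonneg)
    qed
    also have "\<dots> = ennreal (\<Sum>i\<in>Basis. 4 / s * ?C / (1 - s) * (\<Prod>i\<in>Basis. l i) * l i powr (- s))"
      using C s l0 by (intro sum_ennreal) (auto simp: prod_nonneg)
    finally show "gagliardo s u \<le> ennreal (4 / s * ?C / (1 - s) * (\<Prod>i\<in>Basis. l i) * (\<Sum>i\<in>Basis. l i powr (- s)))"
      by (simp add: sum_distrib_left)
    define g where "g i y = (if i = e then ennreal (\<phi> e y / y powr s) * indicator {0<..} y else ennreal (\<phi> i y))" for i y
    have gm: "g i \<in> borel_measurable borel" for i
      unfolding g_def[abs_def] by (cases "i = e") auto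
    have "hardy_integral s (half_space e) u = (\<integral>\<^sup>+ x. (\<Prod>i\<in>Basis. g i (x \<bullet> i)) \<partial>lborel)"
      unfolding hardy_integral_half_space[OF norm_Basis[OF e]]
    proof (rule nn_integral_cong)
      fix x :: 'a
      have "(\<Prod>i\<in>Basis. g i (x \<bullet> i)) = ennreal (\<phi> e (x \<bullet> e) / (x \<bullet> e) powr s) * indicator {0<..} (x \<bullet> e) * (\<Prod>i\<in>Basis - {e}. ennreal (\<phi> i (x \<bullet> i)))"
        by (subst prod.remove[OF _ e]) (auto simp: g_def intro!: arg_cong2[where f="(*)"] prod.cong)
      also have "(\<Prod>i\<in>Basis - {e}. ennreal (\<phi> i (x \<bullet> i))) = ennreal (\<Prod>i\<in>Basis - {e}. \<phi> i (x \<bullet> i))"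
        by (rule prod_ennreal) (rule \<phi>0)
      also have "ennreal (\<phi> e (x \<bullet> e) / (x \<bullet> e) powr s) * indicator {0<..} (x \<bullet> e) * ennreal (\<Prod>i\<in>Basis - {e}. \<phi> i (x \<bullet> i))
        = ennreal (\<phi> e (x \<bullet> e) / (x \<bullet> e) powr s * (\<Prod>i\<in>Basis - {e}. \<phi> i (x \<bullet> i))) * indicator {x. 0 < x \<bullet> e} x"
        using \<phi>0 by (subst ennreal_mult) (auto simp: prod_nonneg indicator_def)
      also have "\<phi> e (x \<bullet> e) / (x \<bullet> e) powr s * (\<Prod>i\<in>Basis - {e}. \<phi> i (x \<bullet> i)) = \<bar>u x\<bar> / (x \<bullet> e) powr s"
        using \<phi>0 prod.remove[OF finite_Basis e, of "\<lambda>i. \<phi> i (x \<bullet> i)"] by (simp add: u_def prod_nonneg abs_prod)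
      finally show "ennreal (\<bar>u x\<bar> / (x \<bullet> e) powr s) * indicator {x. 0 < x \<bullet> e} x = (\<Prod>i\<in>Basis. g i (x \<bullet> i))" ..
    qed
    also have "\<dots> = (\<Prod>i\<in>Basis. (\<integral>\<^sup>+ x. g i x \<partial>lborel))"
      by (rule nn_integral_lborel_prod) (use gm in auto)
    also have "\<dots> = (\<integral>\<^sup>+ x. g e x \<partial>lborel) * (\<Prod>i\<in>Basis - {e}. (\<integral>\<^sup>+ x. g i x \<partial>lborel))"
      by (rule prod.remove[OF _ e]) simp
    also have "(\<Prod>i\<in>Basis - {e}. (\<integral>\<^sup>+ x. g i x \<partial>lborel)) = (\<Prod>i\<in>Basis - {e}. ennreal (l i))"
      by (intro prod.cong) (auto simp: g_def \<phi>I)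
    finally have H: "hardy_integral s (half_space e) u = (\<integral>\<^sup>+ x. g e x \<partial>lborel) * ennreal (\<Prod>i\<in>Basis - {e}. l i)"
      by (simp add: prodI)
    have "ennreal (((l e + 1) powr (1 - s) - 2 powr (1 - s)) / (1 - s)) \<le> (\<integral>\<^sup>+ x. g e x \<partial>lborel)"
    proof (cases "1 \<le> l e")
      case True
      have "ennreal (((l e + 1) powr (1 - s) - 2 powr (1 - s)) / (1 - s))
        = ennreal ((l e + 1) powr (1 - s) / (1 - s) - 2 powr (1 - s) / (1 - s))"
        by (simp add: diff_divide_distrib)
      also have "\<dots> = (\<integral>\<^sup>+ x. ennreal (x powr (- s)) * indicator {2..l e + 1} x \<partial>lborel)"
        using True s
        by (intro nn_integral_FTC_Icc[symmetric]) (auto intro!: derivative_eq_intros)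
      also have "\<dots> \<le> (\<integral>\<^sup>+ x. g e x \<partial>lborel)"
        by (intro nn_integral_mono)
          (auto simp: g_def indicator_def \<phi>_def plateau_eq_1 powr_minus_divide)
      finally show ?thesis .
    next
      case False
      then have "(l e + 1) powr (1 - s) \<le> 2 powr (1 - s)"
        using s l0[of e] by (intro powr_mono2) auto
      then have "((l e + 1) powr (1 - s) - 2 powr (1 - s)) / (1 - s) \<le> 0"
        using s by (intro divide_nonpos_pos) auto
      then show ?thesis by (simp add: ennreal_neg)
    qed
    then have "ennreal (((l e + 1) powr (1 - s) - 2 powr (1 - s)) / (1 - s)) * ennreal (\<Prod>i\<in>Basis - {e}. l i)
      \<le> hardy_integral s (half_space e) u"
      unfolding H by (rule mult_right_mono) simp
    then show "ennreal (((l e + 1) powr (1 - s) - 2 powr (1 - s)) / (1 - s) * (\<Prod>i\<in>Basis - {e}. l i)) \<le> hardy_integral s (half_space e) u"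
      using l0 by (simp only: ennreal_mult'' prod_nonneg)
  qed
qed

text \<open>With width $L$ along $e$ and $L^2$ along the other axes, the lateral faces contribute
  $L^{-2s}$ each against $L^{-s}$, and the distance $1$ kept from the boundary is negligible against $L$;
  so the quotient tends to $4 C_{N,s}/s$.\<close>
lemma hardy_const_half_space_le:
  fixes e :: "'a::euclidean_space"
  assumes s: "0 < s" "s < 1" and e: "e \<in> Basis"
  shows "hardy_const s (half_space e) \<le> ennreal (4 / s * C_const DIM('a) s)"
proof -
  let ?C = "C_const DIM('a) s" and ?N = "real (DIM('a) - 1)"
  have C: "0 < ?C" using s by (intro C_const_pos) (auto simp: Suc_leI)
  define q where "q L = 4 / s * ?C * (L * (L powr (- s) + ?N * (L^2) powr (- s)) / ((L + 1) powr (1 - s) - 2 powr (1 - s)))" for L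
  have "((\<lambda>L. L * (L powr (- s) + ?N * (L^2) powr (- s)) / ((L + 1) powr (1 - s) - 2 powr (1 - s))) \<longlongrightarrow> 1) at_top"
    using s by real_asymp
  then have "(q \<longlongrightarrow> 4 / s * ?C * 1) at_top"
    unfolding q_def by (rule tendsto_mult_left)
  then have lim: "((\<lambda>L. ennreal (q L)) \<longlongrightarrow> ennreal (4 / s * ?C)) at_top"
    by (intro tendsto_ennrealI) simp
  have "\<forall>\<^sub>F L in at_top. hardy_const s (half_space e) \<le> ennreal (q L)"
    using eventually_gt_at_top[of 1]
  proof eventually_elim
    case (elim L)
    define l where "l i = (if i = e then L else L^2)" for i :: 'a
    have l: "0 < l i" for i using elim by (simp add: l_def)
    define R where "R = (\<Prod>i\<in>Basis - {e}. l i)"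
    have R: "0 < R" unfolding R_def by (rule prod_pos) (rule l)
    obtain u where u: "u \<in> smooth_compact_support (half_space e)"
      "gagliardo s u \<le> ennreal (4 / s * ?C / (1 - s) * (\<Prod>i\<in>Basis. l i) * (\<Sum>i\<in>Basis. l i powr (- s)))"
      "ennreal (((l e + 1) powr (1 - s) - 2 powr (1 - s)) / (1 - s) * R) \<le> hardy_integral s (half_space e) u"
      unfolding R_def by (rule box_test_function[OF s e, of l, OF l])
    have P: "(\<Prod>i\<in>Basis. l i) = L * R"
      unfolding R_def by (subst prod.remove[OF _ e]) (auto simp: l_def)
    have "(\<Sum>i\<in>Basis - {e}. l i powr (- s)) = (\<Sum>i\<in>Basis - {e}. (L^2) powr (- s))"
      by (rule sum.cong) (auto simp: l_def)
    then have S: "(\<Sum>i\<in>Basis. l i powr (- s)) = L powr (- s) + ?N * (L^2) powr (- s)"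
      by (subst sum.remove[OF _ e]) (use e in \<open>auto simp: l_def card_Diff_singleton\<close>)
    define A where "A = ((L + 1) powr (1 - s) - 2 powr (1 - s)) / (1 - s) * R"
    define B where "B = 4 / s * ?C / (1 - s) * (L * R) * (L powr (- s) + ?N * (L^2) powr (- s))"
    have D: "0 < (L + 1) powr (1 - s) - 2 powr (1 - s)"
      using elim s by (simp add: powr_less_mono2)
    then have A: "0 < A" using R s by (simp add: A_def)
    have gB: "gagliardo s u \<le> ennreal B" using u(2) by (simp add: B_def P S)
    have hA: "ennreal A \<le> hardy_integral s (half_space e) u" using u(3) by (simp add: A_def l_def)
    \<comment> \<open>The lower bound is used here to see that the weighted integral is finite.\<close>
    have "ennreal (4 / s * ?C) * hardy_integral s (half_space e) u \<le> gagliardo s u"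
      using smooth_compact_supportD[OF u(1)] smooth_compact_support_integrable[OF u(1)]
      by (intro gagliardo_half_space_lower_bound s e norm_Basis) (auto simp: half_space_def)
    also note gB
    finally have fin: "hardy_integral s (half_space e) u < \<infinity>"
      using C s by (cases "hardy_integral s (half_space e) u = \<infinity>") (auto simp: ennreal_mult_top top_unique less_top)
    have "hardy_const s (half_space e) * ennreal A \<le> hardy_const s (half_space e) * hardy_integral s (half_space e) u"
      by (rule mult_left_mono[OF hA]) simp
    also have "\<dots> \<le> gagliardo s u"
      using fin hA A by (intro hardy_const_mult_le u) (auto intro: less_le_trans[of 0 "ennreal A"])
    also note gB
    finally have "hardy_const s (half_space e) * ennreal A * ennreal (1 / A) \<le> ennreal B * ennreal (1 / A)"
      by (rule mult_right_mono) simp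
    also have "hardy_const s (half_space e) * ennreal A * ennreal (1 / A) = hardy_const s (half_space e)"
      using A by (simp add: mult.assoc ennreal_mult[symmetric])
    also have "ennreal B * ennreal (1 / A) = ennreal (B / A)"
      using A by (subst ennreal_mult''[symmetric]) auto
    also have "B / A = q L"
      using R s D by (simp add: A_def B_def q_def)
    finally show ?case .
  qed
  from tendsto_lowerbound[OF lim this] show ?thesis by simp
qed

section \<open>Transplanting test functions to a convex set\<close>

lemma nn_integral_lborel_similarity:
  fixes f :: "'a::euclidean_space \<Rightarrow> 'a" and G :: "'a \<Rightarrow> ennreal"
  assumes f: "linear f" "\<And>x. norm (f x) = norm x" and r: "0 < r"
    and [measurable]: "G \<in> borel_measurable borel"
  shows "(\<integral>\<^sup>+ y. G y \<partial>lborel) = ennreal (r ^ DIM('a)) * (\<integral>\<^sup>+ x. G (p + r *\<^sub>R f x) \<partial>lborel)"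
proof -
  have "(\<integral>\<^sup>+ y. G y \<partial>lborel) = ennreal (r ^ DIM('a)) * (\<integral>\<^sup>+ x. G (p + r *\<^sub>R x) \<partial>lborel)"
    using nn_integral_lborel_scaleR[of G r p] r by simp
  also have "(\<integral>\<^sup>+ x. G (p + r *\<^sub>R x) \<partial>lborel) = (\<integral>\<^sup>+ x. G (p + r *\<^sub>R f x) \<partial>lborel)"
    by (rule nn_integral_lborel_isometry[OF f, symmetric]) measurable
  finally show ?thesis .
qed

lemma gagliardo_similarity:
  fixes f :: "'a::euclidean_space \<Rightarrow> 'a" and u v :: "'a \<Rightarrow> real"
  assumes f: "linear f" "\<And>x. norm (f x) = norm x" and r: "0 < r"
    and [measurable]: "u \<in> borel_measurable borel" "v \<in> borel_measurable borel"
    and v: "\<And>x. v (p + r *\<^sub>R f x) = u x"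
  shows "gagliardo s v = ennreal (r powr (real DIM('a) - s)) * gagliardo s u"
proof -
  let ?N = "DIM('a)"
  have D: "shift_diff v (r *\<^sub>R f h) = ennreal (r ^ ?N) * shift_diff u h" for h
  proof -
    have "v (p + r *\<^sub>R f x + r *\<^sub>R f h) = u (x + h)" for x
      using v[of "x + h"] by (simp add: linear_add[OF f(1)] scaleR_add_right add.assoc)
    then show ?thesis
      unfolding shift_diff_def
      by (subst nn_integral_lborel_similarity[OF f r, of _ p]) (simp_all add: v)
  qed
  have K: "singular_kernel s (r *\<^sub>R f h) = ennreal (r powr (- real ?N - s)) * singular_kernel s h" for h
  proof -
    have "1 / norm (r *\<^sub>R f h) powr (real ?N + s) = r powr (- real ?N - s) * (1 / norm h powr (real ?N + s))"
      using r powr_minus_divide[of r "real ?N + s"] by (simp add: f powr_mult)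
    then show ?thesis unfolding singular_kernel_def by (simp only: ennreal_mult'' zero_le_divide_1_iff powr_ge_zero)
  qed
  have "gagliardo s v = ennreal (r ^ ?N) * (\<integral>\<^sup>+ h. singular_kernel s (0 + r *\<^sub>R f h) * shift_diff v (0 + r *\<^sub>R f h) \<partial>lborel)"
    unfolding gagliardo_eq_shift_diff[OF assms(5)] by (rule nn_integral_lborel_similarity[OF f r]) measurable
  also have "\<dots> = ennreal (r ^ ?N) * (\<integral>\<^sup>+ h. (ennreal (r powr (- real ?N - s)) * ennreal (r ^ ?N)) * (singular_kernel s h * shift_diff u h) \<partial>lborel)"
    by (simp add: D K ac_simps)
  also have "\<dots> = ennreal (r ^ ?N) * ((ennreal (r powr (- real ?N - s)) * ennreal (r ^ ?N)) * gagliardo s u)"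
    unfolding gagliardo_eq_shift_diff[OF assms(4)] by (subst nn_integral_cmult) simp_all
  also have "\<dots> = ennreal (r ^ ?N * r powr (- real ?N - s) * r ^ ?N) * gagliardo s u"
    using r by (simp add: ennreal_mult ac_simps)
  also have "r ^ ?N * r powr (- real ?N - s) * r ^ ?N = r powr (real ?N + (- real ?N - s) + real ?N)"
    using r by (simp only: powr_add powr_realpow)
  also have "real ?N + (- real ?N - s) + real ?N = real ?N - s" by simp
  finally show ?thesis .
qed

text \<open>The ball about any point of $\Omega$ with radius the distance to the boundary touches the boundary at some
  $p$.  Since it lies on one side of the supporting hyperplane at $p$, its radius to $p$ must
  be normal to this hyperplane: the inner product of $x - p$ with the normal is at least
  $r = |x - p|$, which is equality in the Cauchy--Schwarz inequality.\<close>
lemma interior_ball_at_supporting_half_space: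
  fixes \<Omega> :: "'a::euclidean_space set"
  assumes "open \<Omega>" "convex \<Omega>" "\<Omega> \<noteq> {}" "\<Omega> \<noteq> UNIV"
  obtains p a r where "norm a = 1" "0 < r" "ball (p + r *\<^sub>R a) r \<subseteq> \<Omega>"
    "\<And>y. y \<in> \<Omega> \<Longrightarrow> p \<bullet> a < y \<bullet> a"
proof -
  obtain x where x: "x \<in> \<Omega>" using assms(3) by blast
  define r where "r = boundary_dist \<Omega> x"
  obtain p where p: "p \<notin> \<Omega>" "r = dist x p" "0 < r"
    using nearest_boundary_point[OF assms(1) x assms(4)] unfolding r_def by metis
  obtain a where a: "norm a = 1" "\<And>y. y \<in> \<Omega> \<Longrightarrow> p \<bullet> a < y \<bullet> a"
    using supporting_half_space[OF assms(1-3) p(1)] by blast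
  have aa: "a \<bullet> a = 1" using a(1) by (simp add: norm_eq_1)
  have ball: "ball x r \<subseteq> \<Omega>"
  proof
    fix y assume "y \<in> ball x r"
    then show "y \<in> \<Omega>" using boundary_dist_le_dist[OF x, of y] by (auto simp: r_def)
  qed
  have "r \<le> (x - p) \<bullet> a"
  proof (rule dense_le_bounded[OF p(3)])
    fix t assume t: "0 < t" "t < r"
    then have "x - t *\<^sub>R a \<in> ball x r" using a(1) by (simp add: dist_norm)
    then have "p \<bullet> a < (x - t *\<^sub>R a) \<bullet> a" using ball a(2) by blast
    then show "t \<le> (x - p) \<bullet> a" by (simp add: inner_diff_left aa)
  qed
  moreover have "(norm (x - p - r *\<^sub>R a))\<^sup>2 = r\<^sup>2 - 2 * r * ((x - p) \<bullet> a) + r\<^sup>2"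
    using p(2) aa
    by (simp add: power2_norm_eq_inner[of "x - p - r *\<^sub>R a"] inner_diff_left[of "x - p"] inner_diff_right[of _ "x - p"]
        dist_norm power2_norm_eq_inner inner_commute power2_eq_square[of r])
      (simp add: power2_norm_eq_inner[symmetric] power2_eq_square)
  ultimately have "(norm (x - p - r *\<^sub>R a))\<^sup>2 \<le> 0"
    using p(3) by (simp add: power2_eq_square mult_left_mono)
  then have "x = p + r *\<^sub>R a" by (simp add: algebra_simps)
  then show ?thesis using that[OF a(1) p(3) _ a(2)] ball by simp
qed

text \<open>The test function is carried over by the similarity $g(x) = p + c f(x)$, where the reflection $f$
  takes $e$ to the inner normal.  Both sides of the Hardy inequality scale by $c^{N-s}$, and
  on the weighted integral one gains from $d_\Omega(g(x)) \le c\,(x \cdot e)$.\<close>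
lemma hardy_const_convex_le_half_space:
  fixes e :: "'a::euclidean_space" and \<Omega> :: "'a set"
  assumes s: "0 < s" and e: "e \<in> Basis"
    and \<Omega>: "open \<Omega>" "convex \<Omega>" "\<Omega> \<noteq> {}" "\<Omega> \<noteq> UNIV"
  shows "hardy_const s \<Omega> \<le> hardy_const s (half_space e)"
  unfolding hardy_const_def[of s "half_space e"]
proof (rule INF_greatest)
  let ?N = "DIM('a)"
  fix u assume "u \<in> {u \<in> smooth_compact_support (half_space e). hardy_integral s (half_space e) u = 1}"
  then have u: "u \<in> smooth_compact_support (half_space e)" "hardy_integral s (half_space e) u = 1" by auto
  note uD = smooth_compact_supportD[OF u(1)]
  note uD(3) [measurable]
  have C: "0 < C_const ?N s" using s by (intro C_const_pos) (auto simp: Suc_leI)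
  have [measurable]: "\<Omega> \<in> sets borel" using \<Omega>(1) by simp
  show "hardy_const s \<Omega> \<le> gagliardo s u"
  proof (cases "gagliardo s u = \<infinity>")
    case False
    obtain p a r where r: "norm a = 1" "0 < r" "ball (p + r *\<^sub>R a) r \<subseteq> \<Omega>" "\<And>y. y \<in> \<Omega> \<Longrightarrow> p \<bullet> a < y \<bullet> a"
      by (rule interior_ball_at_supporting_half_space[OF \<Omega>]) (rule that)
    obtain f where f: "linear f" "\<And>x y. f x \<bullet> f y = x \<bullet> y" "\<And>x. f (f x) = x" "f e = a"
      by (rule reflection_exists[OF norm_Basis[OF e] r(1)]) (rule that)
    have nf: "norm (f x) = norm x" for x by (simp add: norm_eq_sqrt_inner f)
    have bl: "bounded_linear f" using f(1) by (simp add: linear_conv_bounded_linear)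
    let ?K = "closure {x. u x \<noteq> 0}"
    have K: "compact ?K" "?K \<subseteq> half_space e"
      using u(1) by (auto simp: smooth_compact_support_def)
    have Kn: "?K \<noteq> {}"
    proof
      assume "?K = {}"
      then have "u = (\<lambda>x. 0)" by auto
      then show False using u(2) by (simp add: hardy_integral_def)
    qed
    obtain M where M: "\<And>x. x \<in> ?K \<Longrightarrow> norm x \<le> M"
      using compact_imp_bounded[OF K(1)] by (auto simp: bounded_iff)
    obtain z where z: "z \<in> ?K" "\<And>x. x \<in> ?K \<Longrightarrow> z \<bullet> e \<le> x \<bullet> e"
    proof -
      have "continuous_on ?K (\<lambda>x. x \<bullet> e)" by (intro continuous_intros)
      from continuous_attains_inf[OF K(1) Kn this] show ?thesis using that by blast
    qed
    have ze: "0 < z \<bullet> e" using z(1) K(2) by (auto simp: half_space_def)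
    \<comment> \<open>The image of $x$ lies in the ball as soon as $c |x|^2 < 2 r (x \cdot e)$; $M$ bounds $|x|$ and $z$ minimizes $x \cdot e$ on the support.\<close>
    define c where "c = r * (z \<bullet> e) / (M\<^sup>2 + 1)"
    have M1: "0 < M\<^sup>2 + 1" by (rule add_nonneg_pos) auto
    have c: "0 < c" using r(2) ze M1 by (simp add: c_def)
    define g where "g x = p + c *\<^sub>R f x" for x
    have ga: "g x \<bullet> a = p \<bullet> a + c * (x \<bullet> e)" for x
      using f(2)[of x e] by (simp add: g_def inner_add_left f(4))
    have gK: "g x \<in> \<Omega>" if x: "x \<in> ?K" for x
    proof -
      have fa: "f x \<bullet> a = x \<bullet> e" using f(2)[of x e] by (simp add: f(4))
      have "c * (norm x)\<^sup>2 \<le> c * M\<^sup>2" using M[OF x] c by (intro mult_left_mono power_mono) auto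
      also have "\<dots> < c * (M\<^sup>2 + 1)" using c by simp
      also have "\<dots> = r * (z \<bullet> e)" using M1 by (simp add: c_def)
      also have "\<dots> \<le> r * (x \<bullet> e)" using z(2)[OF x] r(2) by simp
      finally have lt: "c * (norm x)\<^sup>2 < r * (x \<bullet> e)" .
      have xe: "0 < x \<bullet> e" using ze z(2)[OF x] by simp
      have "(norm (c *\<^sub>R f x - r *\<^sub>R a))\<^sup>2 = c * (c * (norm x)\<^sup>2) - 2 * (c * (r * (x \<bullet> e))) + r\<^sup>2"
      proof -
        have "(norm (c *\<^sub>R f x - r *\<^sub>R a))\<^sup>2 = c * (c * (f x \<bullet> f x)) - 2 * (c * (r * (f x \<bullet> a))) + r * (r * (a \<bullet> a))"
          unfolding power2_norm_eq_inner
          by (simp add: inner_diff_left inner_diff_right inner_commute[of a "f x"] algebra_simps)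
        then show ?thesis using r(1) by (simp add: fa nf dot_square_norm power2_eq_square)
      qed
      moreover have "c * (c * (norm x)\<^sup>2) < c * (r * (x \<bullet> e))" using lt c by simp
      moreover have "0 < c * (r * (x \<bullet> e))" using c r(2) xe by simp
      ultimately have "(norm (c *\<^sub>R f x - r *\<^sub>R a))\<^sup>2 < r\<^sup>2" by linarith
      then have "norm (c *\<^sub>R f x - r *\<^sub>R a) < r" using r(2) by (simp add: power2_less_imp_less)
      then have "g x \<in> ball (p + r *\<^sub>R a) r" by (simp add: g_def dist_norm norm_minus_commute)
      then show ?thesis using r(3) by blast
    qed
    define A where "A y = f ((1 / c) *\<^sub>R y)" for y
    have blA: "bounded_linear A"
      unfolding A_def[abs_def] by (intro bounded_linear_compose[OF bl] bounded_linear_scaleR_right)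
    define v where "v y = u (A y + (- A p))" for y
    have vg: "v (p + c *\<^sub>R f x) = u x" for x
      using c linear_add[OF bounded_linear.linear[OF blA]] by (simp add: v_def) (simp add: A_def linear_scale[OF f(1)] f(3))
    have gv: "g (A y + (- A p)) = y" for y
    proof -
      have "A y + (- A p) = f ((1 / c) *\<^sub>R (y - p))"
        by (simp add: A_def linear_diff[OF f(1)] scaleR_diff_right)
      then show ?thesis using c by (simp add: g_def f(3))
    qed
    have all_orders: "times_cont_differentiable k v" for k
      unfolding v_def[abs_def] by (rule times_cont_differentiable_affine[OF blA uD(1)])
    have "continuous_on ?K g"
      unfolding g_def by (intro continuous_intros linear_continuous_on[OF bl])
    then have gc: "compact (g ` ?K)" using K(1) by (rule compact_continuous_image)
    have sub: "{y. v y \<noteq> 0} \<subseteq> g ` ?K"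
    proof
      fix y assume "y \<in> {y. v y \<noteq> 0}"
      then have "A y + (- A p) \<in> ?K" using closure_subset[of "{x. u x \<noteq> 0}"] by (auto simp: v_def)
      then show "y \<in> g ` ?K" using gv by (metis imageI)
    qed
    then have cl: "closure {y. v y \<noteq> 0} \<subseteq> g ` ?K"
      using compact_imp_closed[OF gc] by (rule closure_minimal)
    have "compact (closure {y. v y \<noteq> 0})"
      unfolding compact_closure using compact_imp_bounded[OF gc] sub by (rule bounded_subset)
    then have v: "v \<in> smooth_compact_support \<Omega>"
      using all_orders cl gK by (auto simp: smooth_compact_support_def)
    note vD = smooth_compact_supportD[OF v]
    note vD(3) [measurable]
    define \<mu> where "\<mu> = c powr (real ?N - s)"
    have \<mu>: "0 < \<mu>" using c by (simp add: \<mu>_def)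
    have G: "gagliardo s v = ennreal \<mu> * gagliardo s u"
      unfolding \<mu>_def by (rule gagliardo_similarity[where u = u and p = p, OF f(1) nf c uD(3) vD(3) vg])
    have "ennreal \<mu> * hardy_integral s (half_space e) u
      = (\<integral>\<^sup>+ x. ennreal \<mu> * (ennreal (\<bar>u x\<bar> / (x \<bullet> e) powr s) * indicator {x. 0 < x \<bullet> e} x) \<partial>lborel)"
      unfolding hardy_integral_half_space[OF norm_Basis[OF e]] by (rule nn_integral_cmult[symmetric]) measurable
    also have "\<dots> \<le> (\<integral>\<^sup>+ x. ennreal (c ^ ?N) * (ennreal (\<bar>v (p + c *\<^sub>R f x)\<bar> / boundary_dist \<Omega> (p + c *\<^sub>R f x) powr s) * indicator \<Omega> (p + c *\<^sub>R f x)) \<partial>lborel)"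
    proof (rule nn_integral_mono)
      fix x
      show "ennreal \<mu> * (ennreal (\<bar>u x\<bar> / (x \<bullet> e) powr s) * indicator {x. 0 < x \<bullet> e} x)
        \<le> ennreal (c ^ ?N) * (ennreal (\<bar>v (p + c *\<^sub>R f x)\<bar> / boundary_dist \<Omega> (p + c *\<^sub>R f x) powr s) * indicator \<Omega> (p + c *\<^sub>R f x))"
      proof (cases "u x = 0")
        case nz: False
        then have x: "x \<in> ?K" using closure_subset[of "{x. u x \<noteq> 0}"] by blast
        then have xe: "0 < x \<bullet> e" and gx: "g x \<in> \<Omega>" using K(2) gK by (auto simp: half_space_def)
        let ?d = "boundary_dist \<Omega> (g x)"
        have "g x - (c * (x \<bullet> e)) *\<^sub>R a \<notin> \<Omega>"
          using r(4)[of "g x - (c * (x \<bullet> e)) *\<^sub>R a"] r(1) by (auto simp: inner_diff_left ga norm_eq_1)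
        from boundary_dist_le_dist[OF gx this] have d: "?d \<le> c * (x \<bullet> e)"
          using c xe r(1) by (simp add: dist_norm)
        have d0: "0 < ?d" using nearest_boundary_point[OF \<Omega>(1) gx \<Omega>(4)] by blast
        have "\<mu> * (\<bar>u x\<bar> / (x \<bullet> e) powr s) = c ^ ?N * (\<bar>u x\<bar> / (c * (x \<bullet> e)) powr s)"
          using c xe by (simp add: \<mu>_def powr_diff powr_mult powr_realpow)
        also have "\<dots> \<le> c ^ ?N * (\<bar>u x\<bar> / ?d powr s)"
          using d d0 c s by (intro mult_left_mono divide_left_mono powr_mono2 mult_pos_pos) (auto intro: less_le_trans)
        finally have "ennreal (\<mu> * (\<bar>u x\<bar> / (x \<bullet> e) powr s)) \<le> ennreal (c ^ ?N * (\<bar>u x\<bar> / ?d powr s))"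
          by (rule ennreal_leI)
        then show ?thesis
          using xe gx c \<mu> vg[of x] unfolding g_def[symmetric] by (simp add: ennreal_mult[symmetric])
      qed simp
    qed
    also have "\<dots> = ennreal (c ^ ?N) * (\<integral>\<^sup>+ x. ennreal (\<bar>v (p + c *\<^sub>R f x)\<bar> / boundary_dist \<Omega> (p + c *\<^sub>R f x) powr s) * indicator \<Omega> (p + c *\<^sub>R f x) \<partial>lborel)"
    proof (rule nn_integral_cmult)
      have [measurable]: "f \<in> borel_measurable borel"
        by (rule borel_measurable_continuous_onI) (rule linear_continuous_on[OF bl])
      show "(\<lambda>x. ennreal (\<bar>v (p + c *\<^sub>R f x)\<bar> / boundary_dist \<Omega> (p + c *\<^sub>R f x) powr s) * indicator \<Omega> (p + c *\<^sub>R f x)) \<in> borel_measurable lborel"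
        by measurable
    qed
    also have "\<dots> = hardy_integral s \<Omega> v"
      unfolding hardy_integral_def by (rule nn_integral_lborel_similarity[OF f(1) nf c, symmetric]) measurable
    finally have H: "ennreal \<mu> \<le> hardy_integral s \<Omega> v" by (simp add: u(2))
    \<comment> \<open>Finiteness, needed for the normalization, comes from the lower bound.\<close>
    have "ennreal (2 / s * C_const ?N s) * hardy_integral s \<Omega> v \<le> gagliardo s v"
      by (rule gagliardo_convex_lower_bound[OF s \<Omega>(1,2,4) vD(3,4)])
    also have "\<dots> < \<infinity>" using False by (simp add: G ennreal_mult_less_top less_top)
    finally have fin: "hardy_integral s \<Omega> v < \<infinity>"
      using C s by (cases "hardy_integral s \<Omega> v = \<infinity>") (auto simp: ennreal_mult_top less_top)
    have "hardy_const s \<Omega> * ennreal \<mu> \<le> hardy_const s \<Omega> * hardy_integral s \<Omega> v"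
      by (rule mult_left_mono[OF H]) simp
    also have "\<dots> \<le> gagliardo s v"
      using fin H \<mu> by (intro hardy_const_mult_le v) (auto intro: less_le_trans[of 0 "ennreal \<mu>"])
    finally have "hardy_const s \<Omega> * ennreal \<mu> * ennreal (1 / \<mu>) \<le> ennreal \<mu> * gagliardo s u * ennreal (1 / \<mu>)"
      unfolding G by (rule mult_right_mono) simp
    moreover have m1: "ennreal \<mu> * ennreal (1 / \<mu>) = 1" using \<mu> by (simp add: ennreal_mult[symmetric])
    moreover have "ennreal \<mu> * gagliardo s u * ennreal (1 / \<mu>) = gagliardo s u * (ennreal \<mu> * ennreal (1 / \<mu>))"
      by (simp add: ac_simps)
    ultimately show ?thesis by (simp add: mult.assoc)
  qed simp
qed

lemma hardy_const_lowerI: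
  assumes "\<And>u. u \<in> smooth_compact_support \<Omega> \<Longrightarrow> c * hardy_integral s \<Omega> u \<le> gagliardo s u"
  shows "c \<le> hardy_const s \<Omega>"
  unfolding hardy_const_def
proof (rule INF_greatest)
  fix u assume "u \<in> {u \<in> smooth_compact_support \<Omega>. hardy_integral s \<Omega> u = 1}"
  then show "c \<le> gagliardo s u" using assms[of u] by simp
qed

lemma hardy_const_half_space:
  fixes e :: "'a::euclidean_space"
  assumes s: "0 < s" "s < 1" and e: "e \<in> Basis"
  shows "hardy_const s (half_space e) = ennreal (4 / s * C_const DIM('a) s)"
proof (rule antisym[OF hardy_const_half_space_le[OF assms]], rule hardy_const_lowerI)
  fix u :: "'a \<Rightarrow> real" assume u: "u \<in> smooth_compact_support (half_space e)"
  show "ennreal (4 / s * C_const DIM('a) s) * hardy_integral s (half_space e) u \<le> gagliardo s u"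
    using smooth_compact_supportD[OF u] smooth_compact_support_integrable[OF u]
    by (intro gagliardo_half_space_lower_bound s e norm_Basis) (auto simp: half_space_def)
qed

section \<open>The minimizer on the half-line\<close>

lemma gagliardo_le_of_shift_diff:
  fixes u :: "real \<Rightarrow> real"
  assumes s: "0 < s" "s < 1" and l: "0 \<le> l" and c: "0 \<le> c" and [measurable]: "u \<in> borel_measurable borel"
    and D: "\<And>h. shift_diff u h \<le> ennreal (c * min \<bar>h\<bar> l)"
  shows "gagliardo s u \<le> ennreal (c * (2 / s * (l powr (1 - s) / (1 - s))))"
proof -
  have "gagliardo s u = (\<integral>\<^sup>+ h. singular_kernel s h * shift_diff u h \<partial>lborel)"
    by (rule gagliardo_eq_shift_diff) measurable
  also have "\<dots> \<le> (\<integral>\<^sup>+ h. singular_kernel s h * ennreal (c * min \<bar>h\<bar> l) \<partial>lborel)"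
    by (intro nn_integral_mono mult_left_mono D) simp
  also have "\<dots> = (\<integral>\<^sup>+ h. ennreal c * (singular_kernel s h * ennreal (min \<bar>h \<bullet> (1::real)\<bar> l)) \<partial>lborel)"
    using l c by (simp add: ennreal_mult mult.left_commute inner_real_def)
  also have "\<dots> = ennreal c * (\<integral>\<^sup>+ h. singular_kernel s h * ennreal (min \<bar>h \<bullet> (1::real)\<bar> l) \<partial>lborel)"
    by (rule nn_integral_cmult) measurable
  also have "(\<integral>\<^sup>+ h. singular_kernel s h * ennreal (min \<bar>h \<bullet> (1::real)\<bar> l) \<partial>lborel)
    = ennreal (2 / s * C_const DIM(real) s * (l powr (1 - s) / (1 - s)))"
    by (rule kernel_min_integral[OF s _ l]) simp
  also have "ennreal c * ennreal (2 / s * C_const DIM(real) s * (l powr (1 - s) / (1 - s))) = ennreal (c * (2 / s * (l powr (1 - s) / (1 - s))))"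
    using c l s by (subst ennreal_mult[symmetric]) (auto simp: C_const_1)
  finally show ?thesis .
qed

text \<open>The indicator $\psi$ of $(0,1]$ is the difference of two jumps, so $D_\psi(h) \le 2 \min(|h|, 1)$; this upper
  estimate of the seminorm meets the general lower bound.  The error of the smooth approximation is
  a difference of two translates of $w$, a jump minus a smooth step of width $\delta$.  As $w$
  is supported in $[0, 2\delta]$ and has translation difference at most $2|h|$, its seminorm is
  $O(\delta^{1-s})$.\<close>
lemma hardy_const_half_line_attained:
  assumes s: "0 < s" "s < 1"
  shows "hardy_const_attained s {0 :: real <..}"
proof -
  define S :: "real \<Rightarrow> real" where "S = indicator {0<..}"
  define \<psi> :: "real \<Rightarrow> real" where "\<psi> = indicator {0<..1}"
  define u :: "real \<Rightarrow> real" where "u x = (1 - s) * \<psi> x" for x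
  have [measurable]: "S \<in> borel_measurable borel" "\<psi> \<in> borel_measurable borel"
    unfolding S_def \<psi>_def by measurable
  have [measurable]: "u \<in> borel_measurable borel" unfolding u_def[abs_def] by measurable
  have um: "u \<in> borel_measurable borel" by measurable
  have Sshift: "shift_diff (\<lambda>x. S (x - c)) h = ennreal \<bar>h\<bar>" for c h
    by (rule shift_diff_step[where m = c and M = "c + 1"]) (auto simp: S_def mono_def indicator_def)
  have \<psi>S: "\<psi> = (\<lambda>x. S (x - 0) - S (x - 1))" by (auto simp: \<psi>_def S_def indicator_def)
  have ind: "(\<integral>\<^sup>+ x. ennreal \<bar>\<psi> x\<bar> \<partial>lborel) = 1"
  proof -
    have "(\<integral>\<^sup>+ x. ennreal \<bar>\<psi> x\<bar> \<partial>lborel) = (\<integral>\<^sup>+ x. indicator {0<..1::real} x \<partial>lborel)"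
      by (rule nn_integral_cong) (simp add: \<psi>_def indicator_def)
    then show ?thesis by simp
  qed
  have D\<psi>: "shift_diff \<psi> h \<le> ennreal (2 * min \<bar>h\<bar> 1)" for h
  proof -
    have "shift_diff \<psi> h \<le> ennreal \<bar>h\<bar> + ennreal \<bar>h\<bar>"
      unfolding \<psi>S by (rule order_trans[OF shift_diff_diff]) (simp_all only: Sshift order_refl, measurable)
    then have "shift_diff \<psi> h \<le> ennreal (2 * \<bar>h\<bar>)" by (simp add: ennreal_plus[symmetric] del: ennreal_plus)
    moreover have "shift_diff \<psi> h \<le> ennreal (2 * 1)"
      using shift_diff_le_norm[of \<psi> h] by (simp add: ind)
    ultimately show ?thesis by (simp add: min_def)
  qed
  have "gagliardo s \<psi> \<le> ennreal (2 * (2 / s * (1 powr (1 - s) / (1 - s))))"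
    by (rule gagliardo_le_of_shift_diff[OF s _ _ _ D\<psi>]) auto
  then have "gagliardo s u \<le> ennreal \<bar>1 - s\<bar> * ennreal (2 * (2 / s * (1 powr (1 - s) / (1 - s))))"
    unfolding u_def[abs_def] by (subst gagliardo_cmult) (auto intro: mult_left_mono)
  also have "\<dots> = ennreal (4 / s)" using s by (subst ennreal_mult[symmetric]) (auto simp: field_simps)
  finally have upper: "gagliardo s u \<le> ennreal (4 / s)" .
  have hardy: "hardy_integral s {0<..} u = 1"
  proof -
    have "hardy_integral s {0<..} u = (\<integral>\<^sup>+ x. ennreal (\<bar>u x\<bar> / (x \<bullet> 1) powr s) * indicator {x. 0 < x \<bullet> 1} x \<partial>lborel)"
      using hardy_integral_half_space[of "1::real" s u] by (simp add: half_space_real)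
    also have "\<dots> = (\<integral>\<^sup>+ x. indicator {0..1} x * ennreal ((1 - s) * x powr (- s)) \<partial>lborel)"
      using s by (intro nn_integral_cong) (auto simp: u_def \<psi>_def indicator_def powr_minus_divide abs_mult)
    also have "\<dots> = ennreal ((1 - s) * (1 powr (1 - s) / (1 - s)))"
      using s by (intro nn_integral_powr_from_0) auto
    finally show ?thesis using s by simp
  qed
  have const: "hardy_const s {0 :: real <..} = ennreal (4 / s)"
    using hardy_const_half_space[OF s, of "1::real"] by (simp add: half_space_real C_const_1)
  have fin: "(\<integral>\<^sup>+ x. ennreal \<bar>u x\<bar> \<partial>lborel) < \<infinity>"
  proof -
    have "(\<integral>\<^sup>+ x. ennreal \<bar>u x\<bar> \<partial>lborel) \<le> (\<integral>\<^sup>+ x. ennreal \<bar>\<psi> x\<bar> \<partial>lborel)"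
      using s by (intro nn_integral_mono ennreal_leI) (auto simp: u_def \<psi>_def indicator_def)
    then show ?thesis by (simp add: ind le_less_trans)
  qed
  have "ennreal (4 / s * C_const DIM(real) s) * hardy_integral s (half_space 1) u \<le> gagliardo s u"
    by (rule gagliardo_half_space_lower_bound[OF s(1) _ um fin]) (auto simp: u_def \<psi>_def)
  then have lower: "ennreal (4 / s) \<le> gagliardo s u"
    by (simp add: half_space_real hardy C_const_1)
  have g: "gagliardo s u = hardy_const s {0 :: real <..}"
    using upper lower by (simp add: const)
  have Lp: "(\<integral>\<^sup>+ x. ennreal (\<bar>u x\<bar> powr (real DIM(real) / (real DIM(real) - s))) \<partial>lborel) < \<infinity>"
  proof -
    have "(\<integral>\<^sup>+ x. ennreal (\<bar>u x\<bar> powr (real DIM(real) / (real DIM(real) - s))) \<partial>lborel) \<le> (\<integral>\<^sup>+ x. ennreal \<bar>\<psi> x\<bar> \<partial>lborel)"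
      using s by (intro nn_integral_mono ennreal_leI) (auto simp: u_def \<psi>_def indicator_def intro!: powr_le1)
    then show ?thesis by (simp add: ind le_less_trans)
  qed
  have approx: "\<exists>\<phi>\<in>smooth_compact_support {0<..}. gagliardo s (\<lambda>x. u x - \<phi> x) < ennreal \<epsilon>" if \<epsilon>: "0 < \<epsilon>" for \<epsilon>
  proof -
    obtain F where "smooth_step F" by (rule smooth_step_exists)
    then interpret smooth_step F .
    note F_measurable [measurable]
    have "((\<lambda>\<delta>. 8 / s * (2 * \<delta>) powr (1 - s)) \<longlongrightarrow> 0) (at_right 0)"
      using s by real_asymp
    then have "\<forall>\<^sub>F \<delta> in at_right 0. 8 / s * (2 * \<delta>) powr (1 - s) < \<epsilon> \<and> 0 < \<delta>"
      using \<epsilon> by (intro eventually_conj order_tendstoD eventually_at_right_less)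
    then obtain \<delta> where \<delta>: "0 < \<delta>" "8 / s * (2 * \<delta>) powr (1 - s) < \<epsilon>"
      using eventually_happens[of _ "at_right (0::real)"] by (auto simp: trivial_limit_at_right_real)
    \<comment> \<open>The step starts at $\delta$, not at $0$, to keep the support compact in the open half-line.\<close>
    define T where "T x = F ((x - \<delta>) / \<delta>)" for x
    have [measurable]: "T \<in> borel_measurable borel" unfolding T_def[abs_def] by measurable
    have T0: "T x = 0" if "x \<le> \<delta>" for x
      unfolding T_def using that \<delta>(1) by (intro eq_0) (simp add: divide_nonpos_pos)
    have T1: "T x = 1" if "2 * \<delta> \<le> x" for x
      unfolding T_def using that \<delta>(1) by (intro eq_1) (simp add: field_simps)
    have Tm: "mono T"
      unfolding T_def using \<delta>(1) by (intro monoI monoD[OF mono_F] divide_right_mono) auto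
    have Tr: "0 \<le> T x \<and> T x \<le> 1" for x
      using monoD[OF Tm, of "min x \<delta>" x] T0[of "min x \<delta>"] monoD[OF Tm, of x "max x (2 * \<delta>)"] T1[of "max x (2 * \<delta>)"] by auto
    define w where "w x = S (x - 0) - T x" for x
    have [measurable]: "w \<in> borel_measurable borel" unfolding w_def[abs_def] by measurable
    have wle: "\<bar>w x\<bar> \<le> indicator {0..2 * \<delta>} x" for x
      using T0[of x] T1[of x] Tr[of x] \<delta>(1) by (auto simp: w_def S_def indicator_def)
    have Dw: "shift_diff w h \<le> ennreal (2 * min \<bar>h\<bar> (2 * \<delta>))" for h
    proof -
      have "shift_diff w h \<le> shift_diff (\<lambda>x. S (x - 0)) h + shift_diff T h"
        unfolding w_def[abs_def] by (rule shift_diff_diff) measurable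
      also have "\<dots> = ennreal \<bar>h\<bar> + ennreal \<bar>h\<bar>"
        by (simp only: Sshift shift_diff_step[OF Tm T0 T1])
      finally have "shift_diff w h \<le> ennreal (2 * \<bar>h\<bar>)" by (simp add: ennreal_plus[symmetric] del: ennreal_plus)
      moreover have "shift_diff w h \<le> ennreal (2 * (2 * \<delta>))"
      proof -
        have "(\<integral>\<^sup>+ x. ennreal \<bar>w x\<bar> \<partial>lborel) \<le> (\<integral>\<^sup>+ x. indicator {0..2 * \<delta>} x \<partial>lborel)"
        proof (rule nn_integral_mono)
          fix x show "ennreal \<bar>w x\<bar> \<le> indicator {0..2 * \<delta>} x"
            using ennreal_leI[OF wle[of x]] by (simp add: ennreal_indicator)
        qed
        also have "\<dots> = ennreal (2 * \<delta>)" using \<delta>(1) by simp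
        finally have "2 * (\<integral>\<^sup>+ x. ennreal \<bar>w x\<bar> \<partial>lborel) \<le> 2 * ennreal (2 * \<delta>)" by (rule mult_left_mono) simp
        with shift_diff_le_norm[of w h] show ?thesis
          using \<delta>(1) by (auto simp: ennreal_mult intro: order_trans)
      qed
      ultimately show ?thesis by (simp add: min_def)
    qed
    define \<phi> where "\<phi> x = (1 - s) * (T x - T (x + (- 1)))" for x
    define d where "d x = w x - w (- 1 + x)" for x
    have [measurable]: "d \<in> borel_measurable borel" unfolding d_def[abs_def] by measurable
    have eq: "(\<lambda>x. u x - \<phi> x) = (\<lambda>x. (1 - s) * d x)"
      by (simp add: fun_eq_iff u_def \<phi>_def d_def w_def \<psi>S algebra_simps)
    have Dd: "shift_diff d h \<le> ennreal (4 * min \<bar>h\<bar> (2 * \<delta>))" for h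
    proof -
      have "shift_diff d h \<le> shift_diff w h + shift_diff (\<lambda>x. w (- 1 + x)) h"
        unfolding d_def[abs_def] by (rule shift_diff_diff) measurable
      also have "shift_diff (\<lambda>x. w (- 1 + x)) h = shift_diff w h"
        using shift_diff_shifted[of w "- 1" h] unfolding shift_diff_def[of "\<lambda>x. w (- 1 + x)"]
        by (simp add: algebra_simps)
      also have "shift_diff w h + shift_diff w h \<le> ennreal (2 * min \<bar>h\<bar> (2 * \<delta>)) + ennreal (2 * min \<bar>h\<bar> (2 * \<delta>))"
        by (intro add_mono Dw)
      also have "\<dots> = ennreal (4 * min \<bar>h\<bar> (2 * \<delta>))"
        using \<delta>(1) by (subst ennreal_plus[symmetric]) auto
      finally show ?thesis .
    qed
    have "gagliardo s (\<lambda>x. u x - \<phi> x) = ennreal \<bar>1 - s\<bar> * gagliardo s d"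
      unfolding eq by (rule gagliardo_cmult) measurable
    also have "\<dots> \<le> ennreal \<bar>1 - s\<bar> * ennreal (4 * (2 / s * ((2 * \<delta>) powr (1 - s) / (1 - s))))"
      using \<delta>(1) by (intro mult_left_mono gagliardo_le_of_shift_diff[OF s _ _ _ Dd]) auto
    also have "\<dots> = ennreal (8 / s * (2 * \<delta>) powr (1 - s))"
      using s by (subst ennreal_mult[symmetric]) auto
    also have "\<dots> < ennreal \<epsilon>" using \<delta>(2) \<epsilon> by (intro ennreal_lessI)
    finally have small: "gagliardo s (\<lambda>x. u x - \<phi> x) < ennreal \<epsilon>" .
    have "times_cont_differentiable k T" for k
    proof -
      have "times_cont_differentiable k (\<lambda>x. F ((1 / \<delta>) * x + (- 1)))"
        by (rule times_cont_differentiable_affine[OF bounded_linear_mult_right smooth])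
      then show ?thesis using \<delta>(1) by (simp add: T_def[abs_def] diff_divide_distrib)
    qed
    from times_cont_differentiable_affine[OF bounded_linear_ident this, of _ "- 1"] this
    have all_orders: "times_cont_differentiable k \<phi>" for k
      unfolding \<phi>_def[abs_def] by (intro times_cont_differentiable_mult times_cont_differentiable_const times_cont_differentiable_diff)
    have sub: "{x. \<phi> x \<noteq> 0} \<subseteq> {\<delta>..2 * \<delta> + 1}"
    proof
      fix x assume "x \<in> {x. \<phi> x \<noteq> 0}"
      then have "T x \<noteq> T (x + (- 1))" by (auto simp: \<phi>_def)
      then show "x \<in> {\<delta>..2 * \<delta> + 1}"
        using T0[of x] T0[of "x + (- 1)"] T1[of x] T1[of "x + (- 1)"] \<delta>(1)
        by (cases "x < \<delta>"; cases "2 * \<delta> + 1 < x") auto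
    qed
    then have cl: "closure {x. \<phi> x \<noteq> 0} \<subseteq> {\<delta>..2 * \<delta> + 1}" by (rule closure_minimal) simp
    have "compact (closure {x. \<phi> x \<noteq> 0})"
      unfolding compact_closure using bounded_closed_interval sub by (rule bounded_subset)
    then have "\<phi> \<in> smooth_compact_support {0<..}"
      using all_orders cl \<delta>(1) by (force simp: smooth_compact_support_def)
    with small show ?thesis by blast
  qed
  have "u \<in> W0_space s {0<..}"
    using um Lp approx upper by (auto simp: W0_space_def intro: le_less_trans)
  then show ?thesis unfolding hardy_const_attained_def using hardy g by blast
qed

section \<open>The constant of the one-dimensional problem\<close>

text \<open>The primitive tends to $-1/s$ at $0$ and to $0$ at $1$, because $1 - t^s$ vanishes to first order there
  and $s < 1$.\<close>

lemma Lambda_const_eq: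
  assumes s: "0 < s" "s < 1"
  shows "Lambda_const s = 4 / s"
proof -
  let ?f = "\<lambda>t::real. \<bar>1 - t powr (s - 1)\<bar> / (1 - t) powr (1 + s)"
  let ?F = "\<lambda>t::real. (t powr s - 1) * (1 - t) powr (- s) / s"
  have "(LBINT t=ereal 0..ereal 1. ?f t) = 0 - (- inverse s)"
  proof (rule interval_integral_FTC_nonneg(2)[where F = ?F])
    fix t assume "ereal 0 < ereal t" "ereal t < ereal 1"
    then have t: "0 < t" "t < 1" by auto
    have "1 \<le> t powr (s - 1)"
      using powr_mono2'[of "s - 1" t 1] t s by simp
    then have ab: "\<bar>1 - t powr (s - 1)\<bar> = t powr (s - 1) - 1" by simp
    have e1: "t powr s = t * t powr (s - 1)" using t by (simp add: powr_diff)
    have e2: "(1 - t) powr (- s) = (1 - t) * (1 - t) powr (- s - 1)" using t by (simp add: powr_diff)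
    have e3: "1 / (1 - t) powr (1 + s) = (1 - t) powr (- s - 1)"
    proof -
      have "- s - 1 = - (1 + s)" by simp
      then show ?thesis by (simp only: powr_minus_divide)
    qed
    have "(?F has_real_derivative
        (s * t powr (s - 1) * (1 - t) powr (- s) + (t powr s - 1) * (s * (1 - t) powr (- s - 1))) / s) (at t)"
      using t s by (auto intro!: derivative_eq_intros)
    also have "(s * t powr (s - 1) * (1 - t) powr (- s) + (t powr s - 1) * (s * (1 - t) powr (- s - 1))) / s
        = t powr (s - 1) * (1 - t) powr (- s) + (t powr s - 1) * (1 - t) powr (- s - 1)"
      using s by (simp add: field_simps)
    also have "\<dots> = (t powr (s - 1) - 1) * (1 - t) powr (- s - 1)"
      unfolding e1 e2 by (simp add: algebra_simps)
    also have "\<dots> = ?f t" unfolding ab e3[symmetric] by simp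
    finally show "(?F has_real_derivative ?f t) (at t)" .
    show "isCont ?f t" using t by (auto intro!: continuous_intros)
  next
    have "(?F \<longlongrightarrow> - inverse s) (at_right 0)" using s by real_asymp
    then show "((?F \<circ> real_of_ereal) \<longlongrightarrow> - inverse s) (at_right (ereal 0))"
      by (simp only: ereal_tendsto_simps)
    have "(?F \<longlongrightarrow> 0) (at_left 1)" using s by real_asymp
    then show "((?F \<circ> real_of_ereal) \<longlongrightarrow> 0) (at_left (ereal 1))"
      by (simp only: ereal_tendsto_simps)
  qed auto
  then have "(LBINT t:{0<..<1}. ?f t) = 1 / s"
    by (simp add: interval_lebesgue_integral_def einterval_eq inverse_eq_divide)
  then show ?thesis by (simp add: Lambda_const_def)
qed

section \<open>The sharp constants\<close>

theorem theorem1p1: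
  fixes s :: real and e :: "'a::euclidean_space"
  assumes "0 < s" and "s < 1" and "e \<in> Basis"
  shows "hardy_const s (half_space e) = ennreal (Lambda_const s * C_const DIM('a) s)
       \<and> Lambda_const s = 4 / s
       \<and> (\<forall>\<Omega> :: 'a set. open \<Omega> \<and> convex \<Omega> \<and> \<Omega> \<noteq> {} \<and> \<Omega> \<noteq> UNIV \<longrightarrow>
            1 / 2 * hardy_const s (half_space e) \<le> hardy_const s \<Omega> \<and>
            hardy_const s \<Omega> \<le> hardy_const s (half_space e))
       \<and> hardy_const_attained s {0 :: real <..}"
proof (intro conjI allI impI)
  note s = assms(1,2)
  let ?C = "C_const DIM('a) s"
  have C: "0 < ?C" using s by (intro C_const_pos) (auto simp: Suc_leI)
  show \<Lambda>: "Lambda_const s = 4 / s" by (rule Lambda_const_eq[OF s])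
  show "hardy_const s (half_space e) = ennreal (Lambda_const s * ?C)"
    unfolding \<Lambda> by (rule hardy_const_half_space[OF assms])
  show "hardy_const_attained s {0 :: real <..}" by (rule hardy_const_half_line_attained[OF s])
  fix \<Omega> :: "'a set" assume "open \<Omega> \<and> convex \<Omega> \<and> \<Omega> \<noteq> {} \<and> \<Omega> \<noteq> UNIV"
  then have \<Omega>: "open \<Omega>" "convex \<Omega>" "\<Omega> \<noteq> {}" "\<Omega> \<noteq> UNIV" by auto
  show "hardy_const s \<Omega> \<le> hardy_const s (half_space e)"
    by (rule hardy_const_convex_le_half_space[OF s(1) assms(3) \<Omega>])
  have "ennreal (4 / s * ?C) = 2 * ennreal (2 / s * ?C)"
    using C s by (subst ennreal_numeral[symmetric], subst ennreal_mult[symmetric]) auto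
  then have "1 / 2 * hardy_const s (half_space e) = (1 / 2 * 2) * ennreal (2 / s * ?C)"
    unfolding hardy_const_half_space[OF assms] by (simp only: mult.assoc)
  also have "1 / 2 * 2 = (1 :: ennreal)"
    by (simp add: ennreal_divide_times)
  finally have "1 / 2 * hardy_const s (half_space e) = ennreal (2 / s * ?C)" by simp
  also have "\<dots> \<le> hardy_const s \<Omega>"
  proof (rule hardy_const_lowerI)
    fix u assume "u \<in> smooth_compact_support \<Omega>"
    note uD = smooth_compact_supportD[OF this]
    show "ennreal (2 / s * ?C) * hardy_integral s \<Omega> u \<le> gagliardo s u"
      by (rule gagliardo_convex_lower_bound[OF s(1) \<Omega>(1,2,4) uD(3,4)])
  qed
  finally show "1 / 2 * hardy_const s (half_space e) \<le> hardy_const s \<Omega>" .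
qed

end
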